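(* Fix $x\in\mathbb{R}$. Suppose: (i) the regression function $m(x)=E(\tau\mid X=x)$, the density $f_X(x)>0$ of $X$, and $\sigma^2(x)=E(e^2\mid X=x)$, where $e=\tau-m(X)$, are twice continuously differentiable in $x$; (ii) $nh^5=O(1)$ as $n\to\infty$; (iii) there exist $\delta>0$ and $\bar\sigma>0$ such that $E(|e|^{2+\delta}\mid X)\le\bar\sigma$; (iv) there exist constants $\kappa>0$ and $M_1\in[\kappa,\infty)$ such that $\kappa\le\tau\le M_1$ almost surely; (v) $\psi(\alpha_n)\asymp n^{2/5}$ for some function $\psi:\mathbb{R}^+\to\mathbb{R}$; (vi) $h=h_n=c_0n^{-1/5}$ for some constant $c_0>0$; (vii) $\alpha_n/\log n\to\infty$ as $n\to\infty$. Then $$\tilde\tau_\oplus(x)=\frac{1}{E(\tau)}\,\tau_\oplus(x)+O_p(n^{-2/5})\quad\text{as } n\to\infty.$$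
   Context: Sampling model. Fix $T>0$. $(X,\Lambda)$ is a random pair, where $X$ is a real covariate with density $f_X$ and $\Lambda:[0,T]\to\mathbb{R}^+$ is a random integrable intensity function; $\tau=\int_0^T\Lambda(t)\,dt$. $(X_i,\Lambda_i)$, $i=1,\dots,n$, are i.i.d. copies, with $\tau_i=\int_0^T\Lambda_i$. $(\alpha_n)$ is a sequence of positive numbers. For each $n$, conditionally on $(X_i,\Lambda_i)_{i\le n}$, the point processes $N_1^{(n)},\dots,N_n^{(n)}$ on $[0,T]$ are independent and $N_i^{(n)}$ is a Poisson process with intensity function $\alpha_n\Lambda_i$; so the total count $N_i^{(n)}(T)$ is, given $(X_i,\Lambda_i)$, Poisson with mean $\alpha_n\tau_i$. Write $\bar N(T)=n^{-1}\sum_{i=1}^nN_i^{(n)}(T)$. Target. $\tau_\oplus(x)=\max\{E(\tau\mid X=x),0\}$. Estimator. $K$ is a continuous symmetric probability density with support $[-1,1]$, $h=h_n>0$ is a bandwidth, $K_h(u)=h^{-1}K(u/h)$, $\hat u_j=n^{-1}\sum_{i=1}^nK_h(X_i-x)(X_i-x)^j$ for $j=0,1,2$, $\hat\sigma_0^2=\hat u_0\hat u_2-\hat u_1^2$, $s_{in}(x,h)=\hat\sigma_0^{-2}K_h(X_i-x)[\hat u_2-\hat u_1(X_i-x)]$, and $$\tilde\tau_\oplus(x)=\max\Big(0,\frac{n^{-1}\sum_{i=1}^ns_{in}(x,h)N_i^{(n)}(T)}{\bar N(T)}\Big)$$ (on the events $\hat\sigma_0^2=0$ or $\bar N(T)=0$,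 of vanishing probability, it may be defined arbitrarily). Notation. $\beta_n\asymp\gamma_n$ means $c_1\beta_n\le\gamma_n\le c_2\beta_n$ for some constants $c_1,c_2>0$. *)

theory Defs
  imports "HOL-Probability.Probability" "HOL-Library.Landau_Symbols"
begin

text \<open>
  Nonnegative integrable functions on \<open>[0,T]\<close>; values outside \<open>[0,T]\<close> are irrelevant.  The
  sigma-algebra is the one generated by the maps \<open>l \<mapsto> \<integral>\<^sub>A l\<close> for Borel \<open>A \<subseteq> [0,T]\<close>, that is, intensities
  are random elements of \<open>L\<^sup>1[0,T]\<close>, equivalently random measures.  (With respect to the product
  sigma-algebra of \<open>\<real>\<^bsup>[0,T]\<^esup>\<close> the total mass would not be measurable.)
\<close>
definition intensities :: "real \<Rightarrow> (real \<Rightarrow> real) set" where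
  "intensities T = {l. (\<forall>t\<in>{0..T}. 0 \<le> l t) \<and> set_integrable lborel {0..T} l}"

definition intensity_space :: "real \<Rightarrow> (real \<Rightarrow> real) measure" where
  "intensity_space T = sigma (intensities T)
     {(\<lambda>l. LINT t:A|lborel. l t) -` B \<inter> intensities T | A B.
        A \<in> sets borel \<and> A \<subseteq> {0..T} \<and> B \<in> sets (borel :: real measure)}"

definition total_mass :: "real \<Rightarrow> (real \<Rightarrow> real) \<Rightarrow> real" where
  "total_mass T l = (LINT t:{0..T}|lborel. l t)"

lemma space_intensity_space [simp]: "space (intensity_space T) = intensities T"
  unfolding intensity_space_def by (rule space_measure_of) auto

lemma measurable_set_integral_intensity:
  assumes "A \<in> sets borel" "A \<subseteq> {0..T}"
  shows "(\<lambda>l. LINT t:A|lborel. l t) \<in> borel_measurable (intensity_space T)"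
proof (rule measurableI)
  fix B :: "real set" assume "B \<in> sets borel"
  then have "(\<lambda>l. LINT t:A|lborel. l t) -` B \<inter> intensities T \<in> sets (intensity_space T)"
    unfolding intensity_space_def using assms
    by (subst sets_measure_of) (auto intro!: sigma_sets.Basic)
  then show "(\<lambda>l. LINT t:A|lborel. l t) -` B \<inter> space (intensity_space T) \<in> sets (intensity_space T)"
    by simp
qed simp

lemma measurable_total_mass: "total_mass T \<in> borel_measurable (intensity_space T)"
  unfolding total_mass_def by (rule measurable_set_integral_intensity) auto

text \<open>Throughout, \<open>G\<close> is a sub-sigma-algebra of the probability space \<open>M\<close>.\<close>

definition cond_prob_given :: "'w measure \<Rightarrow> 'w measure \<Rightarrow> 'w set \<Rightarrow> 'w \<Rightarrow> real" where
  "cond_prob_given M G A = real_cond_exp M G (indicat_real A)"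

text \<open>
  Conditional independence of a finite family \<open>(Y\<^sub>i)\<close>.  The product formula for subfamilies is the
  special case in which some of the sets \<open>A i\<close> are the whole space.
\<close>
definition cond_indep_vars ::
  "'w measure \<Rightarrow> 'w measure \<Rightarrow> ('i \<Rightarrow> 'b measure) \<Rightarrow> ('i \<Rightarrow> 'w \<Rightarrow> 'b) \<Rightarrow> 'i set \<Rightarrow> bool" where
  "cond_indep_vars M G S Y I \<longleftrightarrow> finite I \<and> (\<forall>i\<in>I. Y i \<in> measurable M (S i)) \<and>
     (\<forall>A. (\<forall>i\<in>I. A i \<in> sets (S i)) \<longrightarrow>
        (AE w in M. cond_prob_given M G {v \<in> space M. \<forall>i\<in>I. Y i v \<in> A i} w =
                    (\<Prod>i\<in>I. cond_prob_given M G {v \<in> space M. Y i v \<in> A i} w)))"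

text \<open>
  Unlike the library's \<open>poisson_pmf\<close>, this covers rate \<open>0\<close> (unit mass at \<open>0\<close>), which occurs
  when the intensity vanishes on an interval.
\<close>
definition poisson_prob :: "real \<Rightarrow> nat \<Rightarrow> real" where
  "poisson_prob r k = r ^ k / fact k * exp (- r)"

text \<open>A point process on \<open>[0,T]\<close> is given by its counting path, \<open>p t\<close> being the number of points in \<open>[0,t]\<close>.\<close>
definition counting_path :: "real \<Rightarrow> (real \<Rightarrow> nat) \<Rightarrow> bool" where
  "counting_path T p \<longleftrightarrow> p 0 = 0 \<and> mono_on {0..T} p \<and>
     (\<forall>t\<in>{0..<T}. continuous (at_right t) p)"

text \<open>
  Given \<open>G\<close>, the process \<open>N\<close> is a Poisson process on \<open>[0,T]\<close> with the (\<open>G\<close>-measurable) intensity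
  function \<open>l w\<close>.
\<close>
definition cond_poisson_process ::
  "'w measure \<Rightarrow> 'w measure \<Rightarrow> real \<Rightarrow> ('w \<Rightarrow> real \<Rightarrow> real) \<Rightarrow> ('w \<Rightarrow> real \<Rightarrow> nat) \<Rightarrow> bool" where
  "cond_poisson_process M G T l N \<longleftrightarrow>
     (\<forall>w\<in>space M. counting_path T (N w)) \<and>
     (\<forall>t\<in>{0..T}. (\<lambda>w. N w t) \<in> measurable M (count_space UNIV)) \<and>
     (\<forall>s t k. 0 \<le> s \<and> s \<le> t \<and> t \<le> T \<longrightarrow>
        (AE w in M. cond_prob_given M G {v \<in> space M. N v t - N v s = k} w =
                    poisson_prob (LINT u:{s<..t}|lborel. l w u) k)) \<and>
     (\<forall>ts. sorted ts \<and> set ts \<subseteq> {0..T} \<longrightarrow>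
        cond_indep_vars M G (\<lambda>_. count_space UNIV)
          (\<lambda>j w. N w (ts ! Suc j) - N w (ts ! j)) {..<length ts - 1})"

definition pair_space :: "real \<Rightarrow> (real \<times> (real \<Rightarrow> real)) measure" where
  "pair_space T = borel \<Otimes>\<^sub>M intensity_space T"

definition sample_sigma ::
  "'w measure \<Rightarrow> real \<Rightarrow> (nat \<Rightarrow> 'w \<Rightarrow> real) \<Rightarrow> (nat \<Rightarrow> 'w \<Rightarrow> real \<Rightarrow> real) \<Rightarrow> nat \<Rightarrow> 'w measure" where
  "sample_sigma M T Xs Ls n =
     vimage_algebra (space M) (\<lambda>w. \<lambda>i\<in>{1..n}. (Xs i w, Ls i w)) (PiM {1..n} (\<lambda>_. pair_space T))"

definition sampling_model ::
  "'w measure \<Rightarrow> real \<Rightarrow> ('w \<Rightarrow> real) \<Rightarrow> ('w \<Rightarrow> real \<Rightarrow> real) \<Rightarrow> (nat \<Rightarrow> 'w \<Rightarrow> real) \<Rightarrow>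
   (nat \<Rightarrow> 'w \<Rightarrow> real \<Rightarrow> real) \<Rightarrow> (nat \<Rightarrow> real) \<Rightarrow> (nat \<Rightarrow> nat \<Rightarrow> 'w \<Rightarrow> real \<Rightarrow> nat) \<Rightarrow> bool" where
  "sampling_model M T X L Xs Ls \<alpha> N \<longleftrightarrow>
     prob_space M \<and> 0 < T \<and>
     (\<lambda>w. (X w, L w)) \<in> measurable M (pair_space T) \<and>
     prob_space.indep_vars M (\<lambda>_. pair_space T) (\<lambda>i w. (Xs i w, Ls i w)) {1..} \<and>
     (\<forall>i\<ge>1. distr M (pair_space T) (\<lambda>w. (Xs i w, Ls i w)) =
             distr M (pair_space T) (\<lambda>w. (X w, L w))) \<and>
     (\<forall>n\<ge>1. 0 < \<alpha> n) \<and>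
     (\<forall>n\<ge>1. cond_indep_vars M (sample_sigma M T Xs Ls n)
               (\<lambda>_. PiM {0..T} (\<lambda>_. count_space UNIV)) (\<lambda>i w. restrict (N n i w) {0..T}) {1..n} \<and>
             (\<forall>i\<in>{1..n}. cond_poisson_process M (sample_sigma M T Xs Ls n) T
               (\<lambda>w t. \<alpha> n * Ls i w t) (N n i)))"

text \<open>\<open>g\<close> is (a version of) the function \<open>x \<mapsto> E(Y | X = x)\<close>.\<close>
definition regression_function ::
  "'w measure \<Rightarrow> ('w \<Rightarrow> real) \<Rightarrow> ('w \<Rightarrow> real) \<Rightarrow> (real \<Rightarrow> real) \<Rightarrow> bool" where
  "regression_function M X Y g \<longleftrightarrow> integrable M Y \<and> g \<in> borel_measurable borel \<and>
     (AE w in M. real_cond_exp M (vimage_algebra (space M) X borel) Y w = g (X w))"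

definition twice_cont_diff_near :: "(real \<Rightarrow> real) \<Rightarrow> real \<Rightarrow> bool" where
  "twice_cont_diff_near f x \<longleftrightarrow> (\<exists>U f' f''. open U \<and> x \<in> U \<and>
     (\<forall>y\<in>U. (f has_real_derivative f' y) (at y) \<and> (f' has_real_derivative f'' y) (at y)) \<and>
     continuous_on U f'')"

definition smoothing_kernel :: "(real \<Rightarrow> real) \<Rightarrow> bool" where
  "smoothing_kernel K \<longleftrightarrow> continuous_on UNIV K \<and> (\<forall>u. K (- u) = K u) \<and> (\<forall>u. 0 \<le> K u) \<and>
     closure {u. K u \<noteq> 0} = {-1..1} \<and> (K has_integral 1) UNIV"

definition K_scaled :: "(real \<Rightarrow> real) \<Rightarrow> real \<Rightarrow> real \<Rightarrow> real" where
  "K_scaled K h u = K (u / h) / h"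

text \<open>In the following, \<open>xs i\<close> and \<open>c i\<close> are the covariate and the total count of subject \<open>i \<in> {1..n}\<close>.\<close>

definition u_hat :: "(real \<Rightarrow> real) \<Rightarrow> real \<Rightarrow> real \<Rightarrow> nat \<Rightarrow> (nat \<Rightarrow> real) \<Rightarrow> nat \<Rightarrow> real" where
  "u_hat K h x n xs j = (\<Sum>i=1..n. K_scaled K h (xs i - x) * (xs i - x) ^ j) / real n"

definition sigma0_sq_hat :: "(real \<Rightarrow> real) \<Rightarrow> real \<Rightarrow> real \<Rightarrow> nat \<Rightarrow> (nat \<Rightarrow> real) \<Rightarrow> real" where
  "sigma0_sq_hat K h x n xs = u_hat K h x n xs 0 * u_hat K h x n xs 2 - (u_hat K h x n xs 1)\<^sup>2"

definition s_weight :: "(real \<Rightarrow> real) \<Rightarrow> real \<Rightarrow> real \<Rightarrow> nat \<Rightarrow> (nat \<Rightarrow> real) \<Rightarrow> nat \<Rightarrow> real" where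
  "s_weight K h x n xs i = K_scaled K h (xs i - x) *
     (u_hat K h x n xs 2 - u_hat K h x n xs 1 * (xs i - x)) / sigma0_sq_hat K h x n xs"

text \<open>
  Since \<open>a / 0 = 0\<close>, the value is \<open>0\<close> when the denominator \<open>sigma0_sq_hat\<close> or the mean count is zero.
\<close>
definition tau_tilde ::
  "(real \<Rightarrow> real) \<Rightarrow> real \<Rightarrow> real \<Rightarrow> nat \<Rightarrow> (nat \<Rightarrow> real) \<Rightarrow> (nat \<Rightarrow> nat) \<Rightarrow> real" where
  "tau_tilde K h x n xs c =
     max 0 (((\<Sum>i=1..n. s_weight K h x n xs i * real (c i)) / real n) /
            ((\<Sum>i=1..n. real (c i)) / real n))"

definition same_order :: "(nat \<Rightarrow> real) \<Rightarrow> (nat \<Rightarrow> real) \<Rightarrow> bool" where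
  "same_order b g \<longleftrightarrow> (\<exists>c1>0. \<exists>c2>0. \<forall>n\<ge>1. c1 * b n \<le> g n \<and> g n \<le> c2 * b n)"

text \<open>\<open>Z n = O\<^sub>p(r n)\<close>.  Measurability is required because \<open>measure\<close> returns \<open>0\<close> on non-measurable sets.\<close>
definition bigO_prob :: "'w measure \<Rightarrow> (nat \<Rightarrow> 'w \<Rightarrow> real) \<Rightarrow> (nat \<Rightarrow> real) \<Rightarrow> bool" where
  "bigO_prob M Z r \<longleftrightarrow> (\<forall>n\<ge>1. Z n \<in> borel_measurable M) \<and>
     (\<forall>\<epsilon>>0. \<exists>C>0. \<forall>\<^sub>F n in sequentially. measure M {w \<in> space M. \<bar>Z n w\<bar> > C * r n} \<le> \<epsilon>)"

end

(*
  Write Y_i for N_i(T) divided by alpha_n, and k_j(u) = K(u) u^j.  In the rescaled averages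
    U_j = mean of h^-1 k_j((X_i - x)/h),
    D_j = mean of h^-1 k_j((X_i - x)/h) (Y_i - m(x) - m'(x) (X_i - x))
  the local linear estimate based on the Y_i equals m(x) + (U_2 D_0 - U_1 D_1) / (U_0 U_2 - U_1^2),
  because the weights reproduce linear functions.  The U_j converge in L^1 to f_X(x) times the moments
  1, 0, s > 0 of K, so the denominator stays away from 0 with probability tending to 1.

  All rates are obtained in L^1.  The difference Y_i - m(x) - m'(x)(X_i - x) is the Poisson noise
  Y_i - tau_i, which is conditionally centred and uncorrelated with conditional variance tau_i / alpha_n,
  plus a bounded function of the i.i.d. pairs (X_i, tau_i), whose mean against the kernel is O(h^2) by Taylor's
  formula.  Variances are O(1/(nh)), so E|D_j| = O(n^(-2/5)); the mean of the Y_i differs from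
  E(tau) by O(n^(-1/2)) in L^1.  Markov's inequality turns these bounds into the claim.
*)
theory Submission
  imports Defs
begin

section \<open>Conditional moments from conditional Poisson laws\<close>

text \<open>Conditioning is available only through almost sure identities for single events; no
  regular conditional distribution of the counts is given. Conditional moments are therefore
  obtained by summing over the values of a count, or of a pair of counts, under an integral over an
  event of the sigma-algebra; nonnegativity allows sum and integral to be exchanged before
  integrability is known. From there on only moments up to order two enter, so pairwise
  orthogonality replaces independence. Powers of X_i - x are measured in units of h. Every U_j then
  has a finite limit, and the behaviour of the quotient becomes a deterministic statement with a
  threshold that does not depend on n. The line must be removed before absolute values are taken: it
  cancels exactly in the quotient, while with its slope left inside, D_1 could be of order h. The
  estimator is a quotient of counts, so dividing both sides by \<alpha> changes nothing. The
  bandwidth balances the bias h^2 against the standard deviation (nh)^(-1/2), and since eventually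
  \<alpha> is at least 1, the Poisson variance has no larger order than the sampling
  variance.\<close>

lemma poisson_prob_nonneg: "0 \<le> r \<Longrightarrow> 0 \<le> poisson_prob r k"
  by (simp add: poisson_prob_def)

lemma sums_poisson_prob: "poisson_prob r sums 1"
proof -
  have "(\<lambda>k. (r ^ k /\<^sub>R fact k) * exp (- r)) sums (exp r * exp (- r))"
    by (intro sums_mult2 exp_converges)
  then show ?thesis
    by (simp add: poisson_prob_def[abs_def] divide_inverse mult_ac flip: exp_add)
qed

text \<open>One factor of the moment cancels against the factorial. After an index shift each moment
  series becomes r times a series of lower order.\<close>

lemma of_nat_Suc_times_poisson_prob: "real (Suc k) * poisson_prob r (Suc k) = r * poisson_prob r k"
  by (simp add: poisson_prob_def field_simps del: of_nat_Suc)

lemma sums_poisson_mean: "(\<lambda>k. real k * poisson_prob r k) sums r"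
proof -
  have "(\<lambda>k. real (Suc k) * poisson_prob r (Suc k)) sums (r * 1)"
    unfolding of_nat_Suc_times_poisson_prob by (intro sums_mult sums_poisson_prob)
  \<comment> \<open>The shifted series omits only the term with index 0, which vanishes.\<close>
  then show ?thesis
    by (subst (asm) sums_Suc_iff) simp
qed

lemma sums_poisson_second_moment: "(\<lambda>k. (real k)\<^sup>2 * poisson_prob r k) sums (r\<^sup>2 + r)"
proof -
  have "(\<lambda>k. r * (real k * poisson_prob r k + poisson_prob r k)) sums (r * (r + 1))"
    by (intro sums_mult sums_add sums_poisson_prob sums_poisson_mean)
  moreover have "(real (Suc k))\<^sup>2 * poisson_prob r (Suc k)
      = r * (real k * poisson_prob r k + poisson_prob r k)" for k
  proof -
    have "(real (Suc k))\<^sup>2 * poisson_prob r (Suc k) = real (Suc k) * (r * poisson_prob r k)"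
      unfolding of_nat_Suc_times_poisson_prob[symmetric] by (simp add: power2_eq_square)
    then show ?thesis by (simp add: algebra_simps)
  qed
  ultimately have "(\<lambda>k. (real (Suc k))\<^sup>2 * poisson_prob r (Suc k)) sums (r * (r + 1))"
    by simp
  then show ?thesis
    by (subst (asm) sums_Suc_iff) (simp add: algebra_simps power2_eq_square)
qed

lemma nn_integral_count_space_sums:
  fixes f :: "nat \<Rightarrow> real"
  assumes "\<And>k. 0 \<le> f k" "f sums s"
  shows "(\<integral>\<^sup>+k. ennreal (f k) \<partial>count_space UNIV) = ennreal s"
  using assms by (simp add: nn_integral_count_space_nat suminf_ennreal2 sums_summable sums_unique[symmetric])

text \<open>Passage from conditional probabilities of the events \<open>V = k\<close> to the
  conditional mean of \<open>g V\<close>. Since g is nonnegative, everything can be done with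
  extended nonnegative integrals over sets A of F, where summation over k commutes with integration.
  The hypothesis \<open>total\<close> is the value of the series; it is supplied later by the
  Poisson moment sums.\<close>

lemma (in finite_measure_subalgebra) real_cond_exp_of_countable_law:
  fixes V :: "'a \<Rightarrow> 'k :: countable" and g :: "'k \<Rightarrow> real" and q :: "'k \<Rightarrow> 'a \<Rightarrow> real"
  assumes V [measurable]: "V \<in> measurable M (count_space UNIV)"
    and q [measurable]: "\<And>k. q k \<in> borel_measurable F"
    and q_nonneg: "\<And>k. AE w in M. 0 \<le> q k w"
    and law: "\<And>k. AE w in M. cond_prob_given M F {v \<in> space M. V v = k} w = q k w"
    and g: "\<And>k. 0 \<le> g k"
    and s [measurable]: "s \<in> borel_measurable F" and int_s: "integrable M s"
    and s_nonneg: "AE w in M. 0 \<le> s w"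
    and total: "AE w in M. (\<integral>\<^sup>+k. ennreal (g k) * ennreal (q k w) \<partial>count_space UNIV) = ennreal (s w)"
  shows "integrable M (\<lambda>w. g (V w))"
    and "AE w in M. real_cond_exp M F (\<lambda>w. g (V w)) w = s w"
proof -
  have s_M [measurable]: "s \<in> borel_measurable M" and q_M [measurable]: "\<And>k. q k \<in> borel_measurable M"
    using measurable_from_subalg[OF subalg] s q by blast+
  \<comment> \<open>Both conclusions follow from this identity: the whole space as A yields
    integrability, and arbitrary A yields the characterisation of the conditional
    expectation.\<close>
  have key: "(\<integral>\<^sup>+w. ennreal (g (V w)) * indicator A w \<partial>M) = (\<integral>\<^sup>+w. ennreal (s w) * indicator A w \<partial>M)"
    if A: "A \<in> sets F" for A
  proof -
    have [measurable]: "A \<in> sets M" using A subalg by (auto simp: subalgebra_def)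
    have [measurable]: "A \<in> sets F" by fact
    \<comment> \<open>The defining property of the conditional probability of \<open>V = k\<close>,
      tested on A.\<close>
    have step: "(\<integral>\<^sup>+w. indicator {v \<in> space M. V v = k} w * indicator A w \<partial>M)
        = (\<integral>\<^sup>+w. ennreal (q k w) * indicator A w \<partial>M)" for k
    proof -
      define B where "B = {v \<in> space M. V v = k}"
      have [measurable]: "B \<in> sets M" unfolding B_def by measurable
      have int: "integrable M (\<lambda>w. indicat_real A w * indicat_real B w)"
        by (rule integrable_const_bound[where B=1]) (auto simp: indicator_def)
      have AEq: "AE w in M. indicat_real A w * real_cond_exp M F (indicat_real B) w = q k w * indicat_real A w"
        using law[of k] by eventually_elim (simp add: cond_prob_given_def B_def)
      have int_q: "integrable M (\<lambda>w. q k w * indicat_real A w)"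
        using real_cond_exp_intg(1)[OF int] by (subst integrable_cong_AE[OF _ _ AEq, symmetric]) auto
      have eq: "(\<integral>w. q k w * indicat_real A w \<partial>M) = (\<integral>w. indicat_real A w * indicat_real B w \<partial>M)"
        using real_cond_exp_intg(2)[OF int] by (subst integral_cong_AE[OF _ _ AEq, symmetric]) auto
      have "(\<integral>\<^sup>+w. indicator B w * indicator A w \<partial>M)
          = (\<integral>\<^sup>+w. ennreal (indicat_real A w * indicat_real B w) \<partial>M)"
        by (intro nn_integral_cong) (auto simp: indicator_def)
      also have "\<dots> = ennreal (\<integral>w. q k w * indicat_real A w \<partial>M)"
        unfolding eq by (intro nn_integral_eq_integral int) auto
      also have "\<dots> = (\<integral>\<^sup>+w. ennreal (q k w * indicat_real A w) \<partial>M)"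
        using q_nonneg[of k] by (intro nn_integral_eq_integral[symmetric] int_q) auto
      also have "\<dots> = (\<integral>\<^sup>+w. ennreal (q k w) * indicator A w \<partial>M)"
        by (intro nn_integral_cong) (auto simp: indicator_def)
      finally show ?thesis unfolding B_def .
    qed
    \<comment> \<open>At each point w exactly one k contributes, namely \<open>V w\<close>.\<close>
    have pt: "(\<integral>\<^sup>+k. ennreal (g k) * (indicator {v \<in> space M. V v = k} w * indicator A w) \<partial>count_space UNIV)
      = ennreal (g (V w)) * indicator A w" if "w \<in> space M" for w
    proof -
      have "(\<integral>\<^sup>+k. ennreal (g k) * (indicator {v \<in> space M. V v = k} w * indicator A w) \<partial>count_space UNIV)
        = (\<integral>\<^sup>+k. (ennreal (g k) * indicator A w) * indicator {V w} k \<partial>count_space UNIV)"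
        using that by (intro nn_integral_cong) (auto simp: indicator_def)
      also have "\<dots> = ennreal (g (V w)) * indicator A w"
        by (subst nn_integral_indicator_singleton) auto
      finally show ?thesis .
    qed
    have "(\<integral>\<^sup>+w. ennreal (g (V w)) * indicator A w \<partial>M)
      = (\<integral>\<^sup>+w. \<integral>\<^sup>+k. ennreal (g k) * (indicator {v \<in> space M. V v = k} w * indicator A w) \<partial>count_space UNIV \<partial>M)"
      by (intro nn_integral_cong pt[symmetric])
    also have "\<dots> = (\<integral>\<^sup>+k. \<integral>\<^sup>+w. ennreal (g k) * (indicator {v \<in> space M. V v = k} w * indicator A w) \<partial>M \<partial>count_space UNIV)"
      by (intro nn_integral_count_space_nn_integral) auto
    also have "\<dots> = (\<integral>\<^sup>+k. \<integral>\<^sup>+w. ennreal (g k) * (ennreal (q k w) * indicator A w) \<partial>M \<partial>count_space UNIV)"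
      by (rule nn_integral_cong) (simp add: nn_integral_cmult step)
    also have "\<dots> = (\<integral>\<^sup>+w. \<integral>\<^sup>+k. ennreal (g k) * (ennreal (q k w) * indicator A w) \<partial>count_space UNIV \<partial>M)"
      by (intro nn_integral_count_space_nn_integral[symmetric]) auto
    also have "\<dots> = (\<integral>\<^sup>+w. ennreal (s w) * indicator A w \<partial>M)"
    proof (rule nn_integral_cong_AE)
      show "AE w in M. (\<integral>\<^sup>+k. ennreal (g k) * (ennreal (q k w) * indicator A w) \<partial>count_space UNIV)
          = ennreal (s w) * indicator A w"
        using total by eventually_elim (simp add: nn_integral_multc flip: mult.assoc)
    qed
    finally show ?thesis .
  qed
  have gV [measurable]: "(\<lambda>w. g (V w)) \<in> borel_measurable M"
    by (rule measurable_compose[OF V]) simp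
  have "(\<integral>\<^sup>+w. ennreal (g (V w)) \<partial>M) = (\<integral>\<^sup>+w. ennreal (s w) \<partial>M)"
  proof -
    have "(\<integral>\<^sup>+w. ennreal (g (V w)) \<partial>M) = (\<integral>\<^sup>+w. ennreal (g (V w)) * indicator (space F) w \<partial>M)"
      using subalg by (intro nn_integral_cong) (auto simp: subalgebra_def)
    also have "\<dots> = (\<integral>\<^sup>+w. ennreal (s w) * indicator (space F) w \<partial>M)"
      by (rule key) auto
    also have "\<dots> = (\<integral>\<^sup>+w. ennreal (s w) \<partial>M)"
      using subalg by (intro nn_integral_cong) (auto simp: subalgebra_def)
    finally show ?thesis .
  qed
  also have "\<dots> = ennreal (\<integral>w. s w \<partial>M)"
    by (intro nn_integral_eq_integral int_s s_nonneg)
  finally show int_g: "integrable M (\<lambda>w. g (V w))"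
    using g by (intro integrableI_nn_integral_finite[where x="\<integral>w. s w \<partial>M"]) (auto intro: integral_nonneg_AE s_nonneg)
  show "AE w in M. real_cond_exp M F (\<lambda>w. g (V w)) w = s w"
  proof (rule real_cond_exp_charact[OF _ int_g int_s s])
    fix A assume A: "A \<in> sets F"
    then have [measurable]: "A \<in> sets M" using subalg by (auto simp: subalgebra_def)
    have "(\<integral>w\<in>A. g (V w) \<partial>M) = enn2real (\<integral>\<^sup>+w. ennreal (indicat_real A w * g (V w)) \<partial>M)"
      unfolding set_lebesgue_integral_def using g by (subst integral_eq_nn_integral) auto
    also have "(\<integral>\<^sup>+w. ennreal (indicat_real A w * g (V w)) \<partial>M) = (\<integral>\<^sup>+w. ennreal (g (V w)) * indicator A w \<partial>M)"
      by (intro nn_integral_cong) (auto simp: indicator_def)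
    also have "\<dots> = (\<integral>\<^sup>+w. ennreal (s w) * indicator A w \<partial>M)" by (rule key[OF A])
    also have "\<dots> = (\<integral>\<^sup>+w. ennreal (indicat_real A w * s w) \<partial>M)"
      by (intro nn_integral_cong) (auto simp: indicator_def)
    also have "enn2real \<dots> = (\<integral>w\<in>A. s w \<partial>M)"
      unfolding set_lebesgue_integral_def using s_nonneg by (subst integral_eq_nn_integral) auto
    finally show "(\<integral>w\<in>A. g (V w) \<partial>M) = (\<integral>w\<in>A. s w \<partial>M)" .
  qed
qed

section \<open>Averages over the sample\<close>

text \<open>Nonnegativity of the variance of |S|. This turns every second moment bound below into an
  L^1 bound.\<close>

lemma (in prob_space) expectation_abs_le_sqrt:
  assumes [measurable]: "S \<in> borel_measurable M" and S2: "integrable M (\<lambda>w. (S w)\<^sup>2 :: real)"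
  shows "integrable M S" "expectation (\<lambda>w. \<bar>S w\<bar>) \<le> sqrt (expectation (\<lambda>w. (S w)\<^sup>2))"
proof -
  show "integrable M S" using S2 by (rule square_integrable_imp_integrable[rotated]) auto
  then have "integrable M (\<lambda>w. \<bar>S w\<bar>)" by simp
  then have "variance (\<lambda>w. \<bar>S w\<bar>) = expectation (\<lambda>w. \<bar>S w\<bar>\<^sup>2) - (expectation (\<lambda>w. \<bar>S w\<bar>))\<^sup>2"
    using S2 by (intro variance_eq) auto
  then have "(expectation (\<lambda>w. \<bar>S w\<bar>))\<^sup>2 \<le> expectation (\<lambda>w. (S w)\<^sup>2)"
    using variance_positive[of "\<lambda>w. \<bar>S w\<bar>"] by simp
  then show "expectation (\<lambda>w. \<bar>S w\<bar>) \<le> sqrt (expectation (\<lambda>w. (S w)\<^sup>2))"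
    by (rule real_le_rsqrt)
qed

lemma integrable_product_of_squares:
  fixes f g :: "'a \<Rightarrow> real"
  assumes [measurable]: "f \<in> borel_measurable M" "g \<in> borel_measurable M"
    and sq: "integrable M (\<lambda>w. (f w)\<^sup>2)" "integrable M (\<lambda>w. (g w)\<^sup>2)"
  shows "integrable M (\<lambda>w. f w * g w)"
proof (rule Bochner_Integration.integrable_bound)
  show "integrable M (\<lambda>w. (f w)\<^sup>2 + (g w)\<^sup>2)" using sq by simp
  have "\<bar>a * b\<bar> \<le> a\<^sup>2 + b\<^sup>2" for a b :: real
  proof -
    have "0 \<le> (\<bar>a\<bar> - \<bar>b\<bar>)\<^sup>2" by simp
    then have "2 * \<bar>a * b\<bar> \<le> a\<^sup>2 + b\<^sup>2" by (simp add: power2_diff abs_mult)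
    then show ?thesis by (smt (verit))
  qed
  then show "AE w in M. norm (f w * g w) \<le> norm ((f w)\<^sup>2 + (g w)\<^sup>2)" by simp
qed simp

text \<open>Expanding the square leaves only the n diagonal terms, each at most v, over n^2.
  Orthogonality is assumed rather than independence, so that the lemma serves both for centred
  functions of the i.i.d. pairs and for the Poisson noise, whose independence is only
  conditional.\<close>

lemma (in prob_space) expectation_abs_mean_le:
  fixes Z :: "nat \<Rightarrow> 'a \<Rightarrow> real"
  assumes n: "1 \<le> n"
    and Z: "\<And>i. i \<in> {1..n} \<Longrightarrow> Z i \<in> borel_measurable M"
    and sq: "\<And>i. i \<in> {1..n} \<Longrightarrow> integrable M (\<lambda>w. (Z i w)\<^sup>2)"
    and v: "\<And>i. i \<in> {1..n} \<Longrightarrow> expectation (\<lambda>w. (Z i w)\<^sup>2) \<le> v"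
    and orth: "\<And>i j. i \<in> {1..n} \<Longrightarrow> j \<in> {1..n} \<Longrightarrow> i \<noteq> j \<Longrightarrow> expectation (\<lambda>w. Z i w * Z j w) = 0"
  shows "integrable M (\<lambda>w. (\<Sum>i=1..n. Z i w) / real n)"
    and "expectation (\<lambda>w. \<bar>(\<Sum>i=1..n. Z i w) / real n\<bar>) \<le> sqrt (v / real n)"
proof -
  let ?S = "\<lambda>w. (\<Sum>i=1..n. Z i w) / real n"
  have S [measurable]: "?S \<in> borel_measurable M" using Z by (intro borel_measurable_divide borel_measurable_sum) auto
  have sqS: "(?S w)\<^sup>2 = (\<Sum>i=1..n. \<Sum>j=1..n. Z i w * Z j w) / (real n)\<^sup>2" for w
    by (simp add: power_divide power2_eq_square sum_product)
  have int: "integrable M (\<lambda>w. Z i w * Z j w)" if "i \<in> {1..n}" "j \<in> {1..n}" for i j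
    using that Z sq by (intro integrable_product_of_squares) auto
  have S2: "integrable M (\<lambda>w. (?S w)\<^sup>2)"
    unfolding sqS by (intro Bochner_Integration.integrable_divide Bochner_Integration.integrable_sum int) auto
  have "expectation (\<lambda>w. (?S w)\<^sup>2) = (\<Sum>i=1..n. \<Sum>j=1..n. expectation (\<lambda>w. Z i w * Z j w)) / (real n)\<^sup>2"
  proof -
    have "expectation (\<lambda>w. \<Sum>i=1..n. \<Sum>j=1..n. Z i w * Z j w) = (\<Sum>i=1..n. expectation (\<lambda>w. \<Sum>j=1..n. Z i w * Z j w))"
      using int by (intro Bochner_Integration.integral_sum Bochner_Integration.integrable_sum)
    also have "\<dots> = (\<Sum>i=1..n. \<Sum>j=1..n. expectation (\<lambda>w. Z i w * Z j w))"
      using int by (intro sum.cong refl Bochner_Integration.integral_sum) auto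
    finally show ?thesis unfolding sqS by simp
  qed
  also have "(\<Sum>i=1..n. \<Sum>j=1..n. expectation (\<lambda>w. Z i w * Z j w)) = (\<Sum>i=1..n. expectation (\<lambda>w. (Z i w)\<^sup>2))"
  proof (rule sum.cong[OF refl])
    fix i assume i: "i \<in> {1..n}"
    have "(\<Sum>j=1..n. expectation (\<lambda>w. Z i w * Z j w)) = (\<Sum>j\<in>{i}. expectation (\<lambda>w. Z i w * Z j w))"
      using i orth by (intro sum.mono_neutral_right) auto
    then show "(\<Sum>j=1..n. expectation (\<lambda>w. Z i w * Z j w)) = expectation (\<lambda>w. (Z i w)\<^sup>2)"
      by (simp add: power2_eq_square)
  qed
  also have "\<dots> / (real n)\<^sup>2 \<le> (real n * v) / (real n)\<^sup>2"
    using sum_bounded_above[of "{1..n}" "\<lambda>i. expectation (\<lambda>w. (Z i w)\<^sup>2)" v] v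
    by (intro divide_right_mono) auto
  also have "\<dots> = v / real n" using n by (simp add: power2_eq_square)
  finally have le: "expectation (\<lambda>w. (?S w)\<^sup>2) \<le> v / real n" .
  show "integrable M ?S" by (rule expectation_abs_le_sqrt[OF S S2])
  show "expectation (\<lambda>w. \<bar>?S w\<bar>) \<le> sqrt (v / real n)"
    by (rule order_trans[OF expectation_abs_le_sqrt(2)[OF S S2] real_sqrt_le_mono[OF le]])
qed

section \<open>The sample reduced to the pairs of covariate and total mass\<close>

locale poisson_sampling = prob_space M for M :: "'w measure" +
  fixes T :: real and X :: "'w \<Rightarrow> real" and L :: "'w \<Rightarrow> real \<Rightarrow> real"
    and Xs :: "nat \<Rightarrow> 'w \<Rightarrow> real" and Ls :: "nat \<Rightarrow> 'w \<Rightarrow> real \<Rightarrow> real"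
    and \<alpha> :: "nat \<Rightarrow> real" and N :: "nat \<Rightarrow> nat \<Rightarrow> 'w \<Rightarrow> real \<Rightarrow> nat" and b :: real
  assumes model: "sampling_model M T X L Xs Ls \<alpha> N"
    and mass_bounds: "AE w in M. 0 \<le> total_mass T (L w) \<and> total_mass T (L w) \<le> b"
begin

definition \<tau> :: "'w \<Rightarrow> real" where "\<tau> w = total_mass T (L w)"
definition \<tau>s :: "nat \<Rightarrow> 'w \<Rightarrow> real" where "\<tau>s i w = total_mass T (Ls i w)"
definition G :: "nat \<Rightarrow> 'w measure" where "G n = sample_sigma M T Xs Ls n"

lemma T_pos: "0 < T" and \<alpha>_pos: "1 \<le> n \<Longrightarrow> 0 < \<alpha> n"
  using model by (auto simp: sampling_model_def)

text \<open>Random intensities matter only through their total mass. Independence and equality of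
  laws are transported along this map, after which all random elements are real-valued.\<close>

lemma covariate_mass_measurable:
  "(\<lambda>p. (fst p, total_mass T (snd p))) \<in> measurable (pair_space T) borel"
  using measurable_total_mass[of T] unfolding pair_space_def borel_prod[symmetric] by measurable

lemma pair_measurable: "(\<lambda>w. (X w, L w)) \<in> measurable M (pair_space T)"
  and sample_indep: "indep_vars (\<lambda>_. pair_space T) (\<lambda>i w. (Xs i w, Ls i w)) {1..}"
  and sample_distr: "1 \<le> i \<Longrightarrow> distr M (pair_space T) (\<lambda>w. (Xs i w, Ls i w)) = distr M (pair_space T) (\<lambda>w. (X w, L w))"
  using model by (auto simp: sampling_model_def)

lemma sample_measurable: "1 \<le> i \<Longrightarrow> (\<lambda>w. (Xs i w, Ls i w)) \<in> measurable M (pair_space T)"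
  using sample_indep by (auto simp: indep_vars_def)

lemma covariate_mass [measurable]: "(\<lambda>w. (X w, \<tau> w)) \<in> borel_measurable M"
  using measurable_compose[OF pair_measurable covariate_mass_measurable] by (simp add: \<tau>_def)

lemma sample_covariate_mass: "1 \<le> i \<Longrightarrow> (\<lambda>w. (Xs i w, \<tau>s i w)) \<in> borel_measurable M"
  using measurable_compose[OF sample_measurable covariate_mass_measurable] by (simp add: \<tau>s_def)

lemma X_measurable [measurable]: "X \<in> borel_measurable M" and \<tau>_measurable [measurable]: "\<tau> \<in> borel_measurable M"
  using measurable_compose[OF covariate_mass, of fst borel] measurable_compose[OF covariate_mass, of snd borel]
  by (simp_all add: borel_prod[symmetric])

lemma sample_indep_covariate_mass: "indep_vars (\<lambda>_. borel) (\<lambda>i w. (Xs i w, \<tau>s i w)) {1..}"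
  using indep_vars_compose2[OF sample_indep covariate_mass_measurable] by (simp add: \<tau>s_def)

lemma sample_distr_covariate_mass:
  assumes "1 \<le> i"
  shows "distr M borel (\<lambda>w. (Xs i w, \<tau>s i w)) = distr M borel (\<lambda>w. (X w, \<tau> w))"
proof -
  let ?f = "\<lambda>p. (fst p, total_mass T (snd p))"
  have "distr M borel (\<lambda>w. (Xs i w, \<tau>s i w)) = distr (distr M (pair_space T) (\<lambda>w. (Xs i w, Ls i w))) borel ?f"
    by (subst distr_distr[OF covariate_mass_measurable sample_measurable[OF assms]]) (simp add: comp_def \<tau>s_def)
  also have "\<dots> = distr M borel (\<lambda>w. (X w, \<tau> w))"
    unfolding sample_distr[OF assms]
    by (subst distr_distr[OF covariate_mass_measurable pair_measurable]) (simp add: comp_def \<tau>_def)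
  finally show ?thesis .
qed

lemma
  fixes \<phi> :: "real \<times> real \<Rightarrow> real"
  assumes i: "1 \<le> i" and \<phi>: "\<phi> \<in> borel_measurable borel"
  shows sample_integrable_iff: "integrable M (\<lambda>w. \<phi> (Xs i w, \<tau>s i w)) \<longleftrightarrow> integrable M (\<lambda>w. \<phi> (X w, \<tau> w))"
    and sample_expectation: "expectation (\<lambda>w. \<phi> (Xs i w, \<tau>s i w)) = expectation (\<lambda>w. \<phi> (X w, \<tau> w))"
proof -
  note s = sample_covariate_mass[OF i]
  show "integrable M (\<lambda>w. \<phi> (Xs i w, \<tau>s i w)) \<longleftrightarrow> integrable M (\<lambda>w. \<phi> (X w, \<tau> w))"
    using integrable_distr_eq[OF s \<phi>] integrable_distr_eq[OF covariate_mass \<phi>]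
    by (simp add: sample_distr_covariate_mass[OF i])
  show "expectation (\<lambda>w. \<phi> (Xs i w, \<tau>s i w)) = expectation (\<lambda>w. \<phi> (X w, \<tau> w))"
    using integral_distr[OF s \<phi>] integral_distr[OF covariate_mass \<phi>]
    by (simp add: sample_distr_covariate_mass[OF i])
qed

lemma sample_AE_iff:
  assumes i: "1 \<le> i" and P: "{p. P p} \<in> sets (borel :: (real \<times> real) measure)"
  shows "(AE w in M. P (Xs i w, \<tau>s i w)) \<longleftrightarrow> (AE w in M. P (X w, \<tau> w))"
  using AE_distr_iff[OF sample_covariate_mass[OF i], of P] AE_distr_iff[OF covariate_mass, of P] P
  unfolding sample_distr_covariate_mass[OF i] by simp

lemma sample_mass_bounds:
  assumes "1 \<le> i"
  shows "AE w in M. 0 \<le> \<tau>s i w \<and> \<tau>s i w \<le> b"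
proof -
  have "{p :: real \<times> real. 0 \<le> snd p \<and> snd p \<le> b} \<in> sets borel"
    by (intro borel_closed closed_Collect_conj closed_Collect_le continuous_intros)
  from sample_AE_iff[OF assms this] mass_bounds show ?thesis by (simp add: \<tau>_def)
qed

lemma b_nonneg: "0 \<le> b"
proof -
  have "AE w in M. 0 \<le> b" using mass_bounds by eventually_elim simp
  then show ?thesis by simp
qed

text \<open>Centring can only lower the second moment, so a bound v on the raw second moment is
  enough and the mean never has to be computed. The off-diagonal terms vanish by
  independence.\<close>

lemma expectation_abs_sample_mean_le:
  fixes \<phi> :: "real \<times> real \<Rightarrow> real"
  assumes n: "1 \<le> n" and \<phi> [measurable]: "\<phi> \<in> borel_measurable borel"
    and sq: "integrable M (\<lambda>w. (\<phi> (X w, \<tau> w))\<^sup>2)"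
    and v: "expectation (\<lambda>w. (\<phi> (X w, \<tau> w))\<^sup>2) \<le> v"
  defines "\<mu> \<equiv> expectation (\<lambda>w. \<phi> (X w, \<tau> w))"
  shows "integrable M (\<lambda>w. (\<Sum>i=1..n. \<phi> (Xs i w, \<tau>s i w)) / real n - \<mu>)"
    and "expectation (\<lambda>w. \<bar>(\<Sum>i=1..n. \<phi> (Xs i w, \<tau>s i w)) / real n - \<mu>\<bar>) \<le> sqrt (v / real n)"
proof -
  let ?\<phi> = "\<lambda>p. \<phi> p - \<mu>"
  let ?Z = "\<lambda>i w. ?\<phi> (Xs i w, \<tau>s i w)"
  have P [measurable]: "(\<lambda>w. (Xs i w, \<tau>s i w)) \<in> borel_measurable M" if "1 \<le> i" for i
    using sample_covariate_mass[OF that] .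
  have \<phi>M [measurable]: "(\<lambda>w. \<phi> (X w, \<tau> w)) \<in> borel_measurable M"
    by (rule measurable_compose[OF covariate_mass \<phi>])
  have int: "integrable M (\<lambda>w. \<phi> (X w, \<tau> w))"
    using expectation_abs_le_sqrt(1)[OF \<phi>M sq] .
  have sq': "integrable M (\<lambda>w. (?\<phi> (X w, \<tau> w))\<^sup>2)"
    using sq int by (simp add: power2_diff)
  have v': "expectation (\<lambda>w. (?\<phi> (X w, \<tau> w))\<^sup>2) \<le> v"
    using variance_eq[OF int sq] v unfolding \<mu>_def by (smt (verit) zero_le_power2)
  have zero: "expectation (\<lambda>w. ?Z i w) = 0" if "1 \<le> i" for i
    using sample_expectation[OF that, of ?\<phi>] int by (simp add: \<mu>_def prob_space)
  have intZ: "integrable M (?Z i)" if "1 \<le> i" for i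
    using sample_integrable_iff[OF that, of ?\<phi>] int by simp
  have Z: "?Z i \<in> borel_measurable M" if "i \<in> {1..n}" for i
    using measurable_compose[OF P[of i], of ?\<phi> borel] that by simp
  have Z2: "integrable M (\<lambda>w. (?Z i w)\<^sup>2)" if "i \<in> {1..n}" for i
    using sample_integrable_iff[of i "\<lambda>p. (?\<phi> p)\<^sup>2"] sq' that by simp
  have Zv: "expectation (\<lambda>w. (?Z i w)\<^sup>2) \<le> v" if "i \<in> {1..n}" for i
    using sample_expectation[of i "\<lambda>p. (?\<phi> p)\<^sup>2"] v' that by simp
  have orth: "expectation (\<lambda>w. ?Z i w * ?Z j w) = 0" if ij: "i \<in> {1..n}" "j \<in> {1..n}" "i \<noteq> j" for i j
  proof -
    have "indep_vars (\<lambda>_. borel) ?Z {1..}"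
      by (rule indep_vars_compose2[OF sample_indep_covariate_mass]) measurable
    then have "indep_vars (\<lambda>_. borel) ?Z {i, j}"
      by (rule indep_vars_subset) (use ij in auto)
    then have "expectation (\<lambda>w. \<Prod>k\<in>{i, j}. ?Z k w) = (\<Prod>k\<in>{i, j}. expectation (?Z k))"
      using ij intZ by (intro indep_vars_lebesgue_integral) auto
    then show "expectation (\<lambda>w. ?Z i w * ?Z j w) = 0"
      using ij zero by simp
  qed
  have eq: "(\<Sum>i=1..n. ?Z i w) / real n = (\<Sum>i=1..n. \<phi> (Xs i w, \<tau>s i w)) / real n - \<mu>" for w
    using n by (simp add: sum_subtractf diff_divide_distrib)
  show "integrable M (\<lambda>w. (\<Sum>i=1..n. \<phi> (Xs i w, \<tau>s i w)) / real n - \<mu>)"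
    and "expectation (\<lambda>w. \<bar>(\<Sum>i=1..n. \<phi> (Xs i w, \<tau>s i w)) / real n - \<mu>\<bar>) \<le> sqrt (v / real n)"
    using expectation_abs_mean_le[of n ?Z v, OF n Z Z2 Zv orth] unfolding eq by blast+
qed

section \<open>Conditional law and conditional moments of the total counts\<close>

lemma subalgebra_G: "subalgebra M (G n)"
proof -
  let ?S = "\<lambda>w. \<lambda>i\<in>{1..n}. (Xs i w, Ls i w)"
  have S: "?S \<in> measurable M (PiM {1..n} (\<lambda>_. pair_space T))"
    using sample_measurable by (intro measurable_restrict) auto
  have "sets (G n) = {?S -` A \<inter> space M | A. A \<in> sets (PiM {1..n} (\<lambda>_. pair_space T))}"
    unfolding G_def sample_sigma_def using measurable_space[OF S] by (intro sets_vimage_algebra2) blast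
  then show ?thesis
    unfolding subalgebra_def using measurable_sets[OF S] by (auto simp: G_def sample_sigma_def)
qed

sublocale G: finite_measure_subalgebra M "G n" for n
  by unfold_locales (rule subalgebra_G)

lemma G_sample_covariate_mass:
  assumes "i \<in> {1..n}"
  shows "(\<lambda>w. (Xs i w, \<tau>s i w)) \<in> borel_measurable (G n)"
proof -
  have "(\<lambda>w. \<lambda>i\<in>{1..n}. (Xs i w, Ls i w)) \<in> measurable (G n) (PiM {1..n} (\<lambda>_. pair_space T))"
    unfolding G_def sample_sigma_def
  proof (rule measurable_vimage_algebra1)
    show "(\<lambda>w. \<lambda>i\<in>{1..n}. (Xs i w, Ls i w)) \<in> space M \<rightarrow> space (PiM {1..n} (\<lambda>_. pair_space T))"
      using sample_measurable by (intro measurable_space[THEN funcsetI] measurable_restrict) auto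
  qed
  from measurable_compose[OF measurable_compose[OF this measurable_component_singleton[OF assms]] covariate_mass_measurable]
  show ?thesis using assms by (simp add: \<tau>s_def)
qed

lemma G_measurable:
  assumes "i \<in> {1..n}"
  shows "Xs i \<in> borel_measurable (G n)" "\<tau>s i \<in> borel_measurable (G n)"
  using measurable_compose[OF G_sample_covariate_mass[OF assms], of fst borel]
    measurable_compose[OF G_sample_covariate_mass[OF assms], of snd borel]
  by (simp_all add: borel_prod[symmetric])

lemma count_model:
  assumes "1 \<le> n"
  shows "cond_indep_vars M (G n) (\<lambda>_. PiM {0..T} (\<lambda>_. count_space UNIV)) (\<lambda>i w. restrict (N n i w) {0..T}) {1..n}"
    and "i \<in> {1..n} \<Longrightarrow> cond_poisson_process M (G n) T (\<lambda>w t. \<alpha> n * Ls i w t) (N n i)"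
  using model assms unfolding sampling_model_def G_def by auto

lemma count_measurable:
  assumes "i \<in> {1..n}"
  shows "(\<lambda>w. N n i w T) \<in> measurable M (count_space UNIV)"
proof -
  have "1 \<le> n" using assms by simp
  from count_model(2)[OF this assms] show ?thesis
    using T_pos by (auto simp: cond_poisson_process_def)
qed

text \<open>Increments of the process are governed by integrals over half-open intervals, the total
  mass by an integral over the closed one; the endpoint 0 is a null set.\<close>

lemma total_intensity:
  assumes "1 \<le> i" and w: "w \<in> space M"
  shows "(LINT u:{0<..T}|lborel. \<alpha> n * Ls i w u) = \<alpha> n * \<tau>s i w"
proof -
  have "(Xs i w, Ls i w) \<in> space (pair_space T)"
    using measurable_space[OF sample_measurable[OF assms(1)] w] .
  then have int: "set_integrable lborel {0..T} (Ls i w)"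
    by (auto simp: pair_space_def space_pair_measure intensities_def)
  then have int': "set_integrable lborel {0<..T} (Ls i w)"
    by (rule set_integrable_subset) auto
  have "(LINT u:{0<..T}|lborel. Ls i w u) = (LINT u:{0..T}|lborel. Ls i w u)"
  proof (rule set_integral_cong_set)
    show "AE u in lborel. (u \<in> {0..T}) = (u \<in> {0<..T})"
      using AE_lborel_singleton[of 0] by eventually_elim auto
  qed (use int int' in \<open>auto simp: set_integrable_def set_borel_measurable_def\<close>)
  then show ?thesis by (simp add: \<tau>s_def total_mass_def)
qed

text \<open>The total count is the increment from 0 to T, because counting paths start at 0.\<close>

lemma count_law:
  assumes i: "i \<in> {1..n}"
  shows "AE w in M. cond_prob_given M (G n) {v \<in> space M. N n i v T = k} w = poisson_prob (\<alpha> n * \<tau>s i w) k"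
proof -
  have n: "1 \<le> n" and i1: "1 \<le> i" using i by auto
  have cp: "cond_poisson_process M (G n) T (\<lambda>w t. \<alpha> n * Ls i w t) (N n i)"
    by (rule count_model(2)[OF n i])
  then have "AE w in M. cond_prob_given M (G n) {v \<in> space M. N n i v T - N n i v 0 = k} w =
      poisson_prob (LINT u:{0<..T}|lborel. \<alpha> n * Ls i w u) k"
    using T_pos unfolding cond_poisson_process_def by (auto simp: less_imp_le)
  moreover have "{v \<in> space M. N n i v T - N n i v 0 = k} = {v \<in> space M. N n i v T = k}"
    using cp by (auto simp: cond_poisson_process_def counting_path_def)
  ultimately have *: "AE w in M. cond_prob_given M (G n) {v \<in> space M. N n i v T = k} w =
      poisson_prob (LINT u:{0<..T}|lborel. \<alpha> n * Ls i w u) k"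
    by simp
  show ?thesis
    using * AE_space by eventually_elim (simp only: total_intensity[OF i1])
qed

text \<open>Conditional independence is given for whole paths and for all n subjects at once.
  Suitable path events reduce it to two subjects at the single time T.\<close>

lemma joint_count_law:
  assumes i: "i \<in> {1..n}" and j: "j \<in> {1..n}" and ij: "i \<noteq> j"
  shows "AE w in M. cond_prob_given M (G n) {v \<in> space M. (N n i v T, N n j v T) = kl} w
    = poisson_prob (\<alpha> n * \<tau>s i w) (fst kl) * poisson_prob (\<alpha> n * \<tau>s j w) (snd kl)"
proof -
  have n: "1 \<le> n" using i by simp
  let ?S = "PiM {0..T} (\<lambda>_. count_space UNIV) :: (real \<Rightarrow> nat) measure"
  let ?Y = "\<lambda>i w. restrict (N n i w) {0..T}"
  \<comment> \<open>Only the subjects i and j are constrained, and only at time T; for every other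
    index the set is the whole path space.\<close>
  define A where "A q = {p \<in> space ?S. (q = i \<longrightarrow> p T = fst kl) \<and> (q = j \<longrightarrow> p T = snd kl)}" for q
  have comp [measurable]: "(\<lambda>p. p T) \<in> measurable ?S (count_space UNIV)"
    using T_pos by (intro measurable_component_singleton) auto
  have A: "A q \<in> sets ?S" for q
    unfolding A_def by measurable
  have Y: "?Y q w \<in> space ?S" for q w
    by (simp add: space_PiM PiE_def extensional_def)
  have ev: "{v \<in> space M. ?Y q v \<in> A q} =
    {v \<in> space M. (q = i \<longrightarrow> N n q v T = fst kl) \<and> (q = j \<longrightarrow> N n q v T = snd kl)}" for q
    using Y T_pos by (auto simp: A_def)
  have ev_all: "{v \<in> space M. \<forall>q\<in>{1..n}. ?Y q v \<in> A q} = {v \<in> space M. (N n i v T, N n j v T) = kl}"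
    using Y T_pos i j by (auto simp: A_def)
  have prod: "AE w in M. cond_prob_given M (G n) {v \<in> space M. \<forall>q\<in>{1..n}. ?Y q v \<in> A q} w
    = (\<Prod>q\<in>{1..n}. cond_prob_given M (G n) {v \<in> space M. ?Y q v \<in> A q} w)"
    using count_model(1)[OF n] A unfolding cond_indep_vars_def by blast
  \<comment> \<open>The remaining factors are conditional probabilities of the whole space, which
    equal 1 almost everywhere.\<close>
  have "AE w in M. real_cond_exp M (G n) (indicat_real (space M)) w = indicat_real (space M) w"
  proof (rule G.real_cond_exp_F_meas)
    show "integrable M (indicat_real (space M))"
      by (rule integrable_const_bound[where B=1]) auto
    have "space (G n) = space M" using subalgebra_G by (simp add: subalgebra_def)
    then show "indicat_real (space M) \<in> borel_measurable (G n)"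
      using borel_measurable_indicator[OF sets.top[of "G n"], where ?'b=real] by metis
  qed
  then have one: "AE w in M. cond_prob_given M (G n) (space M) w = 1"
    using AE_space by eventually_elim (simp add: cond_prob_given_def)
  show ?thesis
    using prod one count_law[OF i, of "fst kl"] count_law[OF j, of "snd kl"]
  proof eventually_elim
    case (elim w)
    have "(\<Prod>q\<in>{1..n}. cond_prob_given M (G n) {v \<in> space M. ?Y q v \<in> A q} w)
      = (\<Prod>q\<in>{i, j}. cond_prob_given M (G n) {v \<in> space M. ?Y q v \<in> A q} w)"
    proof (rule prod.mono_neutral_right)
      show "\<forall>q\<in>{1..n} - {i, j}. cond_prob_given M (G n) {v \<in> space M. ?Y q v \<in> A q} w = 1"
        unfolding ev using elim(2) by auto
    qed (use i j in auto)
    also have "\<dots> = poisson_prob (\<alpha> n * \<tau>s i w) (fst kl) * poisson_prob (\<alpha> n * \<tau>s j w) (snd kl)"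
      unfolding ev using ij elim(3,4) by simp
    finally show ?case using elim(1) unfolding ev_all by simp
  qed
qed

lemma poisson_prob_measurable [measurable (raw)]:
  assumes [measurable]: "f \<in> borel_measurable F"
  shows "(\<lambda>w. poisson_prob (f w) k) \<in> borel_measurable F"
  unfolding poisson_prob_def by measurable

lemma intensity_nonneg:
  assumes "i \<in> {1..n}"
  shows "AE w in M. 0 \<le> \<alpha> n * \<tau>s i w"
proof -
  have "1 \<le> i" "0 < \<alpha> n" using assms \<alpha>_pos by auto
  then show ?thesis using sample_mass_bounds[of i] by auto
qed

lemma \<tau>s_M_measurable: "1 \<le> i \<Longrightarrow> \<tau>s i \<in> borel_measurable M"
  using measurable_from_subalg[OF subalgebra_G G_measurable(2)[of i i]] by simp

lemma Xs_M_measurable: "1 \<le> i \<Longrightarrow> Xs i \<in> borel_measurable M"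
  using measurable_from_subalg[OF subalgebra_G G_measurable(1)[of i i]] by simp

lemma integrable_intensity_product:
  assumes i: "i \<in> {1..n}" and j: "j \<in> {1..n}"
  shows "integrable M (\<lambda>w. (\<alpha> n * \<tau>s i w) * (\<alpha> n * \<tau>s j w))"
proof (rule integrable_const_bound)
  have b: "AE w in M. 0 \<le> \<tau>s i w \<and> \<tau>s i w \<le> b" "AE w in M. 0 \<le> \<tau>s j w \<and> \<tau>s j w \<le> b"
    using i j sample_mass_bounds by auto
  have \<alpha>: "0 < \<alpha> n" using i \<alpha>_pos by auto
  show "AE w in M. norm ((\<alpha> n * \<tau>s i w) * (\<alpha> n * \<tau>s j w)) \<le> (\<alpha> n * b) * (\<alpha> n * b)"
    using b
  proof eventually_elim
    case (elim w)
    then have "(\<alpha> n * \<tau>s i w) * (\<alpha> n * \<tau>s j w) \<le> (\<alpha> n * b) * (\<alpha> n * b)"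
      using \<alpha> by (intro mult_mono) auto
    then show ?case using elim \<alpha> by (simp add: abs_mult)
  qed
  show "(\<lambda>w. (\<alpha> n * \<tau>s i w) * (\<alpha> n * \<tau>s j w)) \<in> borel_measurable M"
    using i j \<tau>s_M_measurable by (intro borel_measurable_times borel_measurable_const) auto
qed

lemma integrable_intensity:
  assumes i: "i \<in> {1..n}"
  shows "integrable M (\<lambda>w. \<alpha> n * \<tau>s i w)"
proof (rule square_integrable_imp_integrable)
  show "(\<lambda>w. \<alpha> n * \<tau>s i w) \<in> borel_measurable M" using i \<tau>s_M_measurable[of i] by simp
  show "integrable M (\<lambda>w. (\<alpha> n * \<tau>s i w)\<^sup>2)"
    using integrable_intensity_product[OF i i] by (simp only: power2_eq_square)
qed

lemma count_cond_mean:
  assumes i: "i \<in> {1..n}"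
  shows "integrable M (\<lambda>w. real (N n i w T))"
    and "AE w in M. real_cond_exp M (G n) (\<lambda>w. real (N n i w T)) w = \<alpha> n * \<tau>s i w"
proof -
  have [measurable]: "\<tau>s i \<in> borel_measurable (G n)" by (rule G_measurable[OF i])
  have tot: "AE w in M. (\<integral>\<^sup>+k. ennreal (real k) * ennreal (poisson_prob (\<alpha> n * \<tau>s i w) k) \<partial>count_space UNIV)
      = ennreal (\<alpha> n * \<tau>s i w)"
    using intensity_nonneg[OF i]
  proof eventually_elim
    case (elim w)
    then show ?case
      using nn_integral_count_space_sums[OF _ sums_poisson_mean[of "\<alpha> n * \<tau>s i w"]]
      by (simp add: poisson_prob_nonneg flip: ennreal_mult')
  qed
  have nn: "AE w in M. 0 \<le> poisson_prob (\<alpha> n * \<tau>s i w) k" for k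
    using intensity_nonneg[OF i] by eventually_elim (rule poisson_prob_nonneg)
  have q: "(\<lambda>w. poisson_prob (\<alpha> n * \<tau>s i w) k) \<in> borel_measurable (G n)" for k
    by measurable
  note * = G.real_cond_exp_of_countable_law[OF count_measurable[OF i] q nn count_law[OF i] of_nat_0_le_iff _
    integrable_intensity[OF i] intensity_nonneg[OF i] tot]
  show "integrable M (\<lambda>w. real (N n i w T))"
    "AE w in M. real_cond_exp M (G n) (\<lambda>w. real (N n i w T)) w = \<alpha> n * \<tau>s i w"
    by (rule *; measurable)+
qed

lemma count_cond_second_moment:
  assumes i: "i \<in> {1..n}"
  shows "integrable M (\<lambda>w. (real (N n i w T))\<^sup>2)"
    and "AE w in M. real_cond_exp M (G n) (\<lambda>w. (real (N n i w T))\<^sup>2) w = (\<alpha> n * \<tau>s i w)\<^sup>2 + \<alpha> n * \<tau>s i w"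
proof -
  have [measurable]: "\<tau>s i \<in> borel_measurable (G n)" by (rule G_measurable[OF i])
  have tot: "AE w in M. (\<integral>\<^sup>+k. ennreal ((real k)\<^sup>2) * ennreal (poisson_prob (\<alpha> n * \<tau>s i w) k) \<partial>count_space UNIV)
      = ennreal ((\<alpha> n * \<tau>s i w)\<^sup>2 + \<alpha> n * \<tau>s i w)"
    using intensity_nonneg[OF i]
  proof eventually_elim
    case (elim w)
    then show ?case
      using nn_integral_count_space_sums[OF _ sums_poisson_second_moment[of "\<alpha> n * \<tau>s i w"]]
      by (simp add: poisson_prob_nonneg flip: ennreal_mult')
  qed
  have nn: "AE w in M. 0 \<le> poisson_prob (\<alpha> n * \<tau>s i w) k" for k
    using intensity_nonneg[OF i] by eventually_elim (rule poisson_prob_nonneg)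
  have nn2: "AE w in M. 0 \<le> (\<alpha> n * \<tau>s i w)\<^sup>2 + \<alpha> n * \<tau>s i w"
    using intensity_nonneg[OF i] by eventually_elim simp
  have int: "integrable M (\<lambda>w. (\<alpha> n * \<tau>s i w)\<^sup>2 + \<alpha> n * \<tau>s i w)"
    using integrable_intensity_product[OF i i] integrable_intensity[OF i]
    by (intro Bochner_Integration.integrable_add) (simp_all only: power2_eq_square)
  have q: "(\<lambda>w. poisson_prob (\<alpha> n * \<tau>s i w) k) \<in> borel_measurable (G n)" for k
    by measurable
  note * = G.real_cond_exp_of_countable_law[OF count_measurable[OF i] q nn count_law[OF i] zero_le_power2 _ int nn2 tot]
  show "integrable M (\<lambda>w. (real (N n i w T))\<^sup>2)"
    "AE w in M. real_cond_exp M (G n) (\<lambda>w. (real (N n i w T))\<^sup>2) w = (\<alpha> n * \<tau>s i w)\<^sup>2 + \<alpha> n * \<tau>s i w"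
    by (rule *; measurable)+
qed

text \<open>The pair of counts is a single variable with countably many values, so the transfer from
  laws to moments applies to it directly; the double series then factors into two Poisson
  means.\<close>

lemma count_cond_product:
  assumes i: "i \<in> {1..n}" and j: "j \<in> {1..n}" and ij: "i \<noteq> j"
  shows "integrable M (\<lambda>w. real (N n i w T) * real (N n j w T))"
    and "AE w in M. real_cond_exp M (G n) (\<lambda>w. real (N n i w T) * real (N n j w T)) w
      = (\<alpha> n * \<tau>s i w) * (\<alpha> n * \<tau>s j w)"
proof -
  have [measurable]: "\<tau>s i \<in> borel_measurable (G n)" "\<tau>s j \<in> borel_measurable (G n)"
    using G_measurable i j by auto
  let ?q = "\<lambda>kl w. poisson_prob (\<alpha> n * \<tau>s i w) (fst kl) * poisson_prob (\<alpha> n * \<tau>s j w) (snd kl)"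
  let ?g = "\<lambda>kl. real (fst kl) * real (snd kl)"
  have nn': "AE w in M. 0 \<le> \<alpha> n * \<tau>s i w \<and> 0 \<le> \<alpha> n * \<tau>s j w"
    using intensity_nonneg[OF i] intensity_nonneg[OF j] by eventually_elim simp
  have tot: "AE w in M. (\<integral>\<^sup>+kl. ennreal (?g kl) * ennreal (?q kl w) \<partial>count_space UNIV)
      = ennreal ((\<alpha> n * \<tau>s i w) * (\<alpha> n * \<tau>s j w))"
    using nn'
  proof eventually_elim
    case (elim w)
    let ?a = "\<alpha> n * \<tau>s i w" and ?b = "\<alpha> n * \<tau>s j w"
    have mean: "(\<integral>\<^sup>+k. ennreal (real k * poisson_prob r k) \<partial>count_space UNIV) = ennreal r" if "0 \<le> r" for r
      using that by (intro nn_integral_count_space_sums sums_poisson_mean) (simp add: poisson_prob_nonneg)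
    have "(\<integral>\<^sup>+kl. ennreal (?g kl) * ennreal (?q kl w) \<partial>count_space UNIV)
      = (\<integral>\<^sup>+k. \<integral>\<^sup>+l. ennreal (real k * poisson_prob ?a k) * ennreal (real l * poisson_prob ?b l) \<partial>count_space UNIV \<partial>count_space UNIV)"
      using elim by (subst nn_integral_fst_count_space[symmetric], intro nn_integral_cong)
        (simp add: poisson_prob_nonneg mult_ac flip: ennreal_mult')
    also have "\<dots> = ennreal (?a * ?b)"
      using elim by (simp add: nn_integral_cmult nn_integral_multc mean ennreal_mult)
    finally show ?case .
  qed
  have nn: "AE w in M. 0 \<le> ?q kl w" for kl
    using nn' by eventually_elim (simp add: poisson_prob_nonneg)
  have nn2: "AE w in M. 0 \<le> (\<alpha> n * \<tau>s i w) * (\<alpha> n * \<tau>s j w)"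
    using nn' by eventually_elim (simp add: poisson_prob_nonneg)
  have V: "(\<lambda>w. (N n i w T, N n j w T)) \<in> measurable M (count_space UNIV)"
    using count_measurable[OF i] count_measurable[OF j] by measurable
  have g: "0 \<le> ?g kl" for kl by simp
  have q: "?q kl \<in> borel_measurable (G n)" for kl
    by measurable
  note * = G.real_cond_exp_of_countable_law[OF V q nn joint_count_law[OF i j ij] g _ 
      integrable_intensity_product[OF i j] nn2 tot]
  have s: "(\<lambda>w. (\<alpha> n * \<tau>s i w) * (\<alpha> n * \<tau>s j w)) \<in> borel_measurable (G n)" by measurable
  show "integrable M (\<lambda>w. real (N n i w T) * real (N n j w T))"
    "AE w in M. real_cond_exp M (G n) (\<lambda>w. real (N n i w T) * real (N n j w T)) w = (\<alpha> n * \<tau>s i w) * (\<alpha> n * \<tau>s j w)"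
    using *[OF s] by simp_all
qed

end

text \<open>The pull-out property in integrated form, with an explicit version s of the conditional
  expectation. Boundedness of f supplies the integrability of the product.\<close>

lemma (in finite_measure_subalgebra) expectation_mult_cond_exp:
  fixes f g s :: "'a \<Rightarrow> real"
  assumes f [measurable]: "f \<in> borel_measurable F" and bound: "AE w in M. \<bar>f w\<bar> \<le> B"
    and g: "integrable M g" and s: "AE w in M. real_cond_exp M F g w = s w"
    and [measurable]: "s \<in> borel_measurable M"
  shows "integrable M (\<lambda>w. f w * g w)" "integrable M (\<lambda>w. f w * s w)"
    and "(\<integral>w. f w * g w \<partial>M) = (\<integral>w. f w * s w \<partial>M)"
proof -
  have [measurable]: "f \<in> borel_measurable M" by (rule measurable_from_subalg[OF subalg f])
  have gM [measurable]: "g \<in> borel_measurable M" using g by simp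
  show int: "integrable M (\<lambda>w. f w * g w)"
  proof (rule Bochner_Integration.integrable_bound)
    show "integrable M (\<lambda>w. B * g w)" using g by simp
    show "AE w in M. norm (f w * g w) \<le> norm (B * g w)"
      using bound by eventually_elim (auto simp: abs_mult intro!: mult_right_mono)
  qed simp
  have eq: "AE w in M. f w * real_cond_exp M F g w = f w * s w"
    using s by eventually_elim simp
  show "integrable M (\<lambda>w. f w * s w)"
    using real_cond_exp_intg(1)[OF int f gM] by (subst integrable_cong_AE[OF _ _ eq, symmetric]) auto
  show "(\<integral>w. f w * g w \<partial>M) = (\<integral>w. f w * s w \<partial>M)"
    using real_cond_exp_intg(2)[OF int f gM] by (subst integral_cong_AE[OF _ _ eq, symmetric]) auto
qed

section \<open>Moments of the normalised Poisson noise\<close>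

context poisson_sampling
begin

definition noise :: "nat \<Rightarrow> nat \<Rightarrow> 'w \<Rightarrow> real" where
  "noise n i w = real (N n i w T) / \<alpha> n - \<tau>s i w"

lemma noise_measurable:
  assumes i: "i \<in> {1..n}"
  shows "noise n i \<in> borel_measurable M"
proof -
  have [measurable]: "(\<lambda>w. N n i w T) \<in> measurable M (count_space UNIV)" "\<tau>s i \<in> borel_measurable M"
    using count_measurable[OF i] \<tau>s_M_measurable i by auto
  show ?thesis unfolding noise_def by measurable
qed

lemma mass_mult_bound:
  assumes "1 \<le> i" "AE w in M. \<bar>v w\<bar> \<le> B"
  shows "AE w in M. \<bar>v w * \<tau>s i w\<bar> \<le> B * b"
  using assms(2) sample_mass_bounds[OF assms(1)]
proof eventually_elim
  case (elim w)
  then have "\<bar>v w\<bar> * \<bar>\<tau>s i w\<bar> \<le> B * b" by (intro mult_mono) auto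
  then show ?case by (simp add: abs_mult)
qed

text \<open>Expanding the product of the two noises gives four terms. Conditioning turns each into
  the expectation of \<open>v w * (\<tau>s i w * \<tau>s j w)\<close>, with signs +, -, -, +. The
  weight v will be a product of kernel weights at X_i and X_j.\<close>

lemma noise_uncorrelated:
  assumes i: "i \<in> {1..n}" and j: "j \<in> {1..n}" and ij: "i \<noteq> j"
    and v: "v \<in> borel_measurable (G n)" and B: "AE w in M. \<bar>v w\<bar> \<le> B"
  shows "expectation (\<lambda>w. v w * (noise n i w * noise n j w)) = 0"
proof -
  have \<alpha>: "0 < \<alpha> n" using i \<alpha>_pos by auto
  have i1: "1 \<le> i" "1 \<le> j" using i j by auto
  have [measurable]: "\<tau>s i \<in> borel_measurable (G n)" "\<tau>s j \<in> borel_measurable (G n)" "v \<in> borel_measurable (G n)"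
    using G_measurable i j v by auto
  have \<tau>M [measurable]: "\<tau>s i \<in> borel_measurable M" "\<tau>s j \<in> borel_measurable M"
    using \<tau>s_M_measurable i1 by auto
  have vi: "(\<lambda>w. v w * \<tau>s i w) \<in> borel_measurable (G n)" and vj: "(\<lambda>w. v w * \<tau>s j w) \<in> borel_measurable (G n)"
    by measurable
  have m: "(\<lambda>w. (\<alpha> n * \<tau>s i w) * (\<alpha> n * \<tau>s j w)) \<in> borel_measurable M" "(\<lambda>w. \<alpha> n * \<tau>s i w) \<in> borel_measurable M"
    "(\<lambda>w. \<alpha> n * \<tau>s j w) \<in> borel_measurable M"
    by measurable
  note 1 = G.expectation_mult_cond_exp[OF v B count_cond_product[OF i j ij] m(1)]
  note 2 = G.expectation_mult_cond_exp[OF vj mass_mult_bound[OF i1(2) B] count_cond_mean[OF i] m(2)]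
  note 3 = G.expectation_mult_cond_exp[OF vi mass_mult_bound[OF i1(1) B] count_cond_mean[OF j] m(3)]
  let ?P = "expectation (\<lambda>w. v w * (\<tau>s i w * \<tau>s j w))"
  let ?a = "\<lambda>w. v w * (real (N n i w T) * real (N n j w T))"
  let ?b = "\<lambda>w. v w * \<tau>s j w * real (N n i w T)"
  let ?c = "\<lambda>w. v w * \<tau>s i w * real (N n j w T)"
  let ?d = "\<lambda>w. v w * (\<tau>s i w * \<tau>s j w)"
  have "integrable M (\<lambda>w. v w * ((\<alpha> n * \<tau>s i w) * (\<alpha> n * \<tau>s j w)) / (\<alpha> n)\<^sup>2)"
    using 1(2) by simp
  then have d: "integrable M ?d" using \<alpha> by (simp add: power2_eq_square mult_ac)
  have a': "expectation ?a = (\<alpha> n)\<^sup>2 * ?P"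
    unfolding 1(3) by (subst integral_mult_right_zero[symmetric]) (simp add: power2_eq_square mult_ac)
  have b': "expectation ?b = \<alpha> n * ?P"
    unfolding 2(3) by (subst integral_mult_right_zero[symmetric]) (simp add: mult_ac)
  have c': "expectation ?c = \<alpha> n * ?P"
    unfolding 3(3) by (subst integral_mult_right_zero[symmetric]) (simp add: mult_ac)
  have "v w * (noise n i w * noise n j w) = ?a w / (\<alpha> n)\<^sup>2 - ?b w / \<alpha> n - ?c w / \<alpha> n + ?d w" for w
    using \<alpha> by (simp add: noise_def field_simps power2_eq_square)
  then have "expectation (\<lambda>w. v w * (noise n i w * noise n j w))
    = expectation ?a / (\<alpha> n)\<^sup>2 - expectation ?b / \<alpha> n - expectation ?c / \<alpha> n + expectation ?d"
    using 1(1) 2(1) 3(1) d by simp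
  also have "\<dots> = 0" unfolding a' b' c' using \<alpha> by simp
  finally show ?thesis .
qed

text \<open>Given the sample, the normalised count has second moment
  \<open>(\<tau>s i w)\<^sup>2 + \<tau>s i w / \<alpha> n\<close>; the squares cancel and the
  Poisson variance remains.\<close>

lemma noise_second_moment:
  assumes i: "i \<in> {1..n}"
    and v: "v \<in> borel_measurable (G n)" and B: "AE w in M. \<bar>v w\<bar> \<le> B"
  shows "integrable M (\<lambda>w. v w * (noise n i w)\<^sup>2)"
    and "expectation (\<lambda>w. v w * (noise n i w)\<^sup>2) = expectation (\<lambda>w. v w * \<tau>s i w) / \<alpha> n"
proof -
  have \<alpha>: "0 < \<alpha> n" using i \<alpha>_pos by auto
  have i1: "1 \<le> i" using i by auto
  have [measurable]: "\<tau>s i \<in> borel_measurable (G n)" "v \<in> borel_measurable (G n)"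
    using G_measurable i v by auto
  have \<tau>M [measurable]: "\<tau>s i \<in> borel_measurable M" "v \<in> borel_measurable M"
    using \<tau>s_M_measurable i1 measurable_from_subalg[OF subalgebra_G v] by auto
  have vi: "(\<lambda>w. v w * \<tau>s i w) \<in> borel_measurable (G n)"
    by measurable
  have m: "(\<lambda>w. (\<alpha> n * \<tau>s i w)\<^sup>2 + \<alpha> n * \<tau>s i w) \<in> borel_measurable M" "(\<lambda>w. \<alpha> n * \<tau>s i w) \<in> borel_measurable M"
    by measurable
  note 1 = G.expectation_mult_cond_exp[OF v B count_cond_second_moment[OF i] m(1)]
  note 2 = G.expectation_mult_cond_exp[OF vi mass_mult_bound[OF i1 B] count_cond_mean[OF i] m(2)]
  let ?a = "\<lambda>w. v w * (real (N n i w T))\<^sup>2"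
  let ?b = "\<lambda>w. v w * \<tau>s i w * real (N n i w T)"
  let ?d = "\<lambda>w. v w * (\<tau>s i w)\<^sup>2"
  let ?e = "\<lambda>w. v w * \<tau>s i w"
  have e: "integrable M ?e"
    by (rule integrable_const_bound[where B="B * b"]) (use mass_mult_bound[OF i1 B] in auto)
  have d: "integrable M ?d"
    by (rule integrable_const_bound[where B="B * b * b"])
      (use mass_mult_bound[OF i1 mass_mult_bound[OF i1 B]] in \<open>auto simp: power2_eq_square mult_ac\<close>)
  have "expectation ?a = expectation (\<lambda>w. (\<alpha> n)\<^sup>2 * ?d w + \<alpha> n * ?e w)"
    unfolding 1(3) by (simp add: power2_eq_square algebra_simps)
  then have a': "expectation ?a = (\<alpha> n)\<^sup>2 * expectation ?d + \<alpha> n * expectation ?e"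
    using d e by simp
  have b': "expectation ?b = \<alpha> n * expectation ?d"
    unfolding 2(3) by (subst integral_mult_right_zero[symmetric]) (simp add: power2_eq_square mult_ac)
  have eq: "v w * (noise n i w)\<^sup>2 = ?a w / (\<alpha> n)\<^sup>2 - 2 * ?b w / \<alpha> n + ?d w" for w
    using \<alpha> by (simp add: noise_def field_simps power2_eq_square)
  show "integrable M (\<lambda>w. v w * (noise n i w)\<^sup>2)"
    unfolding eq using 1(1) 2(1) d by simp
  have "expectation (\<lambda>w. v w * (noise n i w)\<^sup>2)
    = expectation ?a / (\<alpha> n)\<^sup>2 - 2 * expectation ?b / \<alpha> n + expectation ?d"
    unfolding eq using 1(1) 2(1) d by simp
  also have "\<dots> = expectation ?e / \<alpha> n" unfolding a' b' using \<alpha> by (simp add: field_simps power2_eq_square)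
  finally show "expectation (\<lambda>w. v w * (noise n i w)\<^sup>2) = expectation ?e / \<alpha> n" .
qed

text \<open>The sup bound B serves integrability only and does not enter the estimate. This matters
  for kernel weights: their supremum is of order 1/h, so its square would cost 1/h^2, whereas their
  second moment is of order 1/h.\<close>

lemma expectation_abs_noise_mean_le:
  fixes g :: "real \<Rightarrow> real"
  assumes n: "1 \<le> n" and g [measurable]: "g \<in> borel_measurable borel" and B: "\<And>y. \<bar>g y\<bar> \<le> B"
  shows "integrable M (\<lambda>w. (\<Sum>i=1..n. g (Xs i w) * noise n i w) / real n)"
    and "expectation (\<lambda>w. \<bar>(\<Sum>i=1..n. g (Xs i w) * noise n i w) / real n\<bar>)
      \<le> sqrt (b * expectation (\<lambda>w. (g (X w))\<^sup>2) / \<alpha> n / real n)"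
proof -
  let ?Z = "\<lambda>i w. g (Xs i w) * noise n i w"
  let ?v = "b * expectation (\<lambda>w. (g (X w))\<^sup>2) / \<alpha> n"
  have gG: "(\<lambda>w. g (Xs i w)) \<in> borel_measurable (G n)" if "i \<in> {1..n}" for i
    using measurable_compose[OF G_measurable(1)[OF that] g] .
  have B0: "0 \<le> B" using B[of 0] by linarith
  have B2: "\<bar>g y * g z\<bar> \<le> B * B" for y z
    using mult_mono[OF B[of y] B[of z]] B0 by (simp add: abs_mult)
  have gg: "g y * g y \<le> B * B" for y using B2[of y y] by simp
  have int_g2: "integrable M (\<lambda>w. (g (X w))\<^sup>2)"
    by (rule integrable_const_bound[where B="B * B"]) (use gg in \<open>auto simp: power2_eq_square\<close>)
  have Z: "?Z i \<in> borel_measurable M" if "i \<in> {1..n}" for i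
    using measurable_from_subalg[OF subalgebra_G gG[OF that]] noise_measurable[OF that] by measurable
  have Z2: "integrable M (\<lambda>w. (?Z i w)\<^sup>2)" and Zv: "expectation (\<lambda>w. (?Z i w)\<^sup>2) \<le> ?v" if i: "i \<in> {1..n}" for i
  proof -
    have i1: "1 \<le> i" using i by simp
    have \<alpha>: "0 < \<alpha> n" using n \<alpha>_pos by auto
    have v: "(\<lambda>w. (g (Xs i w))\<^sup>2) \<in> borel_measurable (G n)" using gG[OF i] by measurable
    have vB: "AE w in M. \<bar>(g (Xs i w))\<^sup>2\<bar> \<le> B * B" using gg by (simp add: power2_eq_square)
    have m2: "(\<lambda>p. (g (fst p))\<^sup>2 :: real) \<in> borel_measurable (borel :: (real \<times> real) measure)"
      and m3: "(\<lambda>p. (g (fst p))\<^sup>2 * snd p :: real) \<in> borel_measurable (borel :: (real \<times> real) measure)"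
      unfolding borel_prod[symmetric] by measurable
    show "integrable M (\<lambda>w. (?Z i w)\<^sup>2)"
      using noise_second_moment(1)[OF i v vB] by (simp add: power_mult_distrib)
    have "expectation (\<lambda>w. (?Z i w)\<^sup>2) = expectation (\<lambda>w. (g (X w))\<^sup>2 * \<tau> w) / \<alpha> n"
      using noise_second_moment(2)[OF i v vB] sample_expectation[OF i1 m3] by (simp add: power_mult_distrib)
    also have "expectation (\<lambda>w. (g (X w))\<^sup>2 * \<tau> w) \<le> expectation (\<lambda>w. b * (g (X w))\<^sup>2)"
    proof (rule integral_mono_AE)
      show "AE w in M. (g (X w))\<^sup>2 * \<tau> w \<le> b * (g (X w))\<^sup>2"
        using mass_bounds by eventually_elim (simp add: \<tau>_def mult.commute mult_right_mono)
      then have "AE w in M. norm ((g (X w))\<^sup>2 * \<tau> w) \<le> norm (b * (g (X w))\<^sup>2)"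
        using mass_bounds by eventually_elim (simp add: \<tau>_def abs_mult)
      then show "integrable M (\<lambda>w. (g (X w))\<^sup>2 * \<tau> w)"
        by (rule Bochner_Integration.integrable_bound[rotated 2]) (use int_g2 in auto)
    qed (use int_g2 in simp)
    finally show "expectation (\<lambda>w. (?Z i w)\<^sup>2) \<le> ?v"
      using \<alpha> by (simp add: divide_right_mono)
  qed
  have orth: "expectation (\<lambda>w. ?Z i w * ?Z j w) = 0" if ij: "i \<in> {1..n}" "j \<in> {1..n}" "i \<noteq> j" for i j
  proof -
    have "expectation (\<lambda>w. (g (Xs i w) * g (Xs j w)) * (noise n i w * noise n j w)) = 0"
      by (rule noise_uncorrelated[OF ij borel_measurable_times[OF gG[OF ij(1)] gG[OF ij(2)]], of "B * B"])
        (use B2 in auto)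
    then show ?thesis by (simp add: mult_ac)
  qed
  show "integrable M (\<lambda>w. (\<Sum>i=1..n. g (Xs i w) * noise n i w) / real n)"
    and "expectation (\<lambda>w. \<bar>(\<Sum>i=1..n. g (Xs i w) * noise n i w) / real n\<bar>) \<le> sqrt (?v / real n)"
    using expectation_abs_mean_le[of n ?Z ?v, OF n Z Z2 Zv orth] by blast+
qed

end

section \<open>Kernel averages\<close>

text \<open>Wide enough to contain K(u) u^j and absolute values of such functions, hence without
  conditions on sign or mass. Continuity and compact support give boundedness and
  integrability.\<close>

definition compact_kernel :: "(real \<Rightarrow> real) \<Rightarrow> bool" where
  "compact_kernel k \<longleftrightarrow> continuous_on UNIV k \<and> (\<forall>u. 1 < \<bar>u\<bar> \<longrightarrow> k u = 0)"

text \<open>For k = K this is \<open>K_scaled\<close> centred at x. For k(u) = K(u) u^j it carries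
  the factor ((y - x)/h)^j, so the resulting averages have the same order for all j.\<close>

definition rescale :: "(real \<Rightarrow> real) \<Rightarrow> real \<Rightarrow> real \<Rightarrow> real \<Rightarrow> real" where
  "rescale k x h y = k ((y - x) / h) / h"

lemma compact_kernel_measurable:
  "compact_kernel k \<Longrightarrow> k \<in> borel_measurable borel"
  unfolding compact_kernel_def by (auto intro: borel_measurable_continuous_onI)

lemma rescale_measurable:
  assumes "compact_kernel k"
  shows "rescale k x h \<in> borel_measurable borel"
proof -
  note [measurable] = compact_kernel_measurable[OF assms]
  show ?thesis unfolding rescale_def[abs_def] by measurable
qed

lemma compact_kernel_abs: "compact_kernel k \<Longrightarrow> compact_kernel (\<lambda>u. \<bar>k u\<bar>)"
  unfolding compact_kernel_def by (auto intro: continuous_intros)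

lemma rescale_abs: "0 < h \<Longrightarrow> rescale (\<lambda>u. \<bar>k u\<bar>) x h y = \<bar>rescale k x h y\<bar>"
  by (simp add: rescale_def)

lemma rescale_eq_0:
  assumes "compact_kernel k" "0 < h" "h < \<bar>y - x\<bar>"
  shows "rescale k x h y = 0"
  using assms by (simp add: rescale_def compact_kernel_def)

lemma compact_kernel_bounded:
  assumes "compact_kernel k"
  obtains B where "0 < B" "\<And>u. \<bar>k u\<bar> \<le> B"
proof -
  have "continuous_on {-1..1} k" using assms by (auto simp: compact_kernel_def intro: continuous_on_subset)
  then have "bounded (k ` {-1..1})" by (intro compact_imp_bounded compact_continuous_image) auto
  then obtain B where B: "0 < B" "\<And>u. u \<in> {-1..1} \<Longrightarrow> \<bar>k u\<bar> \<le> B"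
    by (auto simp: bounded_pos)
  have "\<bar>k u\<bar> \<le> B" for u
  proof (cases "1 < \<bar>u\<bar>")
    case True
    then show ?thesis using assms B(1) by (simp add: compact_kernel_def)
  next
    case False
    then have "u \<in> {-1..1}" by (simp add: abs_if split: if_splits)
    then show ?thesis by (rule B(2))
  qed
  with B(1) that show ?thesis by blast
qed

lemma compact_kernel_integrable:
  assumes "compact_kernel k"
  shows "integrable lborel k"
proof -
  have "set_integrable lborel {-1..1} k"
    using assms by (intro borel_integrable_atLeastAtMost') (auto simp: compact_kernel_def intro: continuous_on_subset)
  moreover have "indicat_real {-1..1} u *\<^sub>R k u = k u" for u
  proof (cases "u \<in> {-1..1}")
    case False
    then have "1 < \<bar>u\<bar>" by (simp add: abs_if not_le) linarith
    then show ?thesis using assms by (simp add: compact_kernel_def)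
  qed simp
  ultimately show ?thesis by (simp only: set_integrable_def)
qed

lemma rescale_integral:
  assumes "compact_kernel k" "0 < h"
  shows "integrable lborel (rescale k x h)" "(\<integral>y. rescale k x h y \<partial>lborel) = (\<integral>u. k u \<partial>lborel)"
proof -
  have eq: "rescale k x h (x + h * u) = k u / h" for u
    using assms by (simp add: rescale_def)
  have "integrable lborel (\<lambda>u. rescale k x h (x + h * u))"
    unfolding eq using compact_kernel_integrable[OF assms(1)] by simp
  then show "integrable lborel (rescale k x h)"
    using lborel_integrable_real_affine_iff[of h "rescale k x h" x] assms(2) by simp
  show "(\<integral>y. rescale k x h y \<partial>lborel) = (\<integral>u. k u \<partial>lborel)"
    using lborel_integral_real_affine[of h "rescale k x h" x] assms(2) unfolding eq by simp
qed

text \<open>The rescaled kernel vanishes beyond distance h from x, so f is seen only where it is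
  within \<epsilon> of c. The error is the integral of |f - c| against the absolute kernel, whose
  mass does not depend on h.\<close>

lemma rescale_local_average:
  assumes k: "compact_kernel k" and h: "0 < h"
    and f [measurable]: "f \<in> borel_measurable borel" and near: "\<forall>y. \<bar>y - x\<bar> \<le> h \<longrightarrow> \<bar>f y - c\<bar> \<le> \<epsilon>"
  shows "integrable lborel (\<lambda>y. f y * rescale k x h y)"
    and "\<bar>(\<integral>y. f y * rescale k x h y \<partial>lborel) - c * (\<integral>u. k u \<partial>lborel)\<bar> \<le> \<epsilon> * (\<integral>u. \<bar>k u\<bar> \<partial>lborel)"
proof -
  note [measurable] = rescale_measurable[OF k]
  note int = rescale_integral[OF k h, of x]
  note int_abs = rescale_integral[OF compact_kernel_abs[OF k] h, of x, unfolded rescale_abs[OF h]]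
  have le: "\<bar>(f y - c) * rescale k x h y\<bar> \<le> \<epsilon> * \<bar>rescale k x h y\<bar>" for y
    using near[rule_format, of y] rescale_eq_0[OF k h, of y x] by (cases "\<bar>y - x\<bar> \<le> h") (auto simp: abs_mult mult_right_mono)
  have d: "integrable lborel (\<lambda>y. (f y - c) * rescale k x h y)"
  proof (rule Bochner_Integration.integrable_bound)
    show "integrable lborel (\<lambda>y. \<epsilon> * \<bar>rescale k x h y\<bar>)" using int_abs(1) by simp
    show "AE y in lborel. norm ((f y - c) * rescale k x h y) \<le> norm (\<epsilon> * \<bar>rescale k x h y\<bar>)"
      by (intro AE_I2) (simp only: real_norm_def, rule order_trans[OF le abs_ge_self])
  qed measurable
  have "integrable lborel (\<lambda>y. (f y - c) * rescale k x h y + c * rescale k x h y)"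
    using d int(1) by simp
  then show fi: "integrable lborel (\<lambda>y. f y * rescale k x h y)" by (simp add: algebra_simps)
  have "(\<integral>y. f y * rescale k x h y \<partial>lborel) - c * (\<integral>u. k u \<partial>lborel)
    = (\<integral>y. (f y - c) * rescale k x h y \<partial>lborel)"
    using fi int by (simp add: left_diff_distrib)
  also have "\<bar>\<dots>\<bar> \<le> (\<integral>y. \<epsilon> * \<bar>rescale k x h y\<bar> \<partial>lborel)"
    by (rule order_trans[OF integral_abs_bound]) (intro integral_mono le integrable_abs integrable_mult_right d int_abs(1))
  finally show "\<bar>(\<integral>y. f y * rescale k x h y \<partial>lborel) - c * (\<integral>u. k u \<partial>lborel)\<bar> \<le> \<epsilon> * (\<integral>u. \<bar>k u\<bar> \<partial>lborel)"
    using int_abs(2) by simp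
qed

lemma smoothing_kernelD:
  assumes "smoothing_kernel K"
  shows "continuous_on UNIV K" "K (- u) = K u" "0 \<le> K u" "closure {u. K u \<noteq> 0} = {-1..1}" "(K has_integral 1) UNIV"
  using assms unfolding smoothing_kernel_def by blast+

lemma compact_kernel_monomial:
  assumes K: "smoothing_kernel K"
  shows "compact_kernel (\<lambda>u. K u * u ^ j)"
proof -
  have 0: "K u = 0" if "1 < \<bar>u\<bar>" for u
  proof (rule ccontr)
    assume "K u \<noteq> 0"
    then have "u \<in> closure {u. K u \<noteq> 0}" by (intro closure_subset[THEN subsetD] CollectI)
    then have "u \<in> {-1..1}" unfolding smoothing_kernelD(4)[OF K] .
    with that show False by auto
  qed
  show ?thesis
    unfolding compact_kernel_def
    using continuous_on_mult[OF smoothing_kernelD(1)[OF K] continuous_on_power[OF continuous_on_id]] 0 by simp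
qed

lemma smoothing_kernel_integral:
  assumes "smoothing_kernel K"
  shows "(\<integral>u. K u \<partial>lborel) = 1"
proof -
  have "integrable lborel K" using compact_kernel_integrable[OF compact_kernel_monomial[OF assms, of 0]] by simp
  then have "(K has_integral (\<integral>u. K u \<partial>lborel)) UNIV" by (rule has_integral_integral_lborel)
  then show ?thesis by (rule has_integral_unique[OF _ smoothing_kernelD(5)[OF assms]])
qed

text \<open>The integrand is odd: reflection shows that the integral equals its own
  negative.\<close>

lemma smoothing_kernel_first_moment:
  assumes "smoothing_kernel K"
  shows "(\<integral>u. K u * u \<partial>lborel) = 0"
proof -
  have "(\<integral>u. K u * u \<partial>lborel) = (\<integral>u. K (- u) * (- u) \<partial>lborel)"
    using lborel_integral_real_affine[of "-1" "\<lambda>u. K u * u" 0] by simp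
  also have "\<dots> = - (\<integral>u. K u * u \<partial>lborel)"
    by (simp add: smoothing_kernelD(2)[OF assms])
  finally show ?thesis by simp
qed

text \<open>A zero second moment would force K to vanish almost everywhere, contradicting its unit
  mass.\<close>

lemma smoothing_kernel_second_moment_pos:
  assumes K: "smoothing_kernel K"
  shows "0 < (\<integral>u. K u * u\<^sup>2 \<partial>lborel)"
proof -
  have nn: "0 \<le> K u * u\<^sup>2" for u using smoothing_kernelD(3)[OF K, of u] by simp
  have "(\<integral>u. K u * u\<^sup>2 \<partial>lborel) \<noteq> 0"
  proof
    assume "(\<integral>u. K u * u\<^sup>2 \<partial>lborel) = 0"
    then have "AE u in lborel. K u * u\<^sup>2 = 0"
      using integral_nonneg_eq_0_iff_AE[OF compact_kernel_integrable[OF compact_kernel_monomial[OF K, of 2]]] nn by simp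
    then have "AE u in lborel. K u = 0"
      using AE_lborel_singleton[of 0] by eventually_elim auto
    then have "(\<integral>u. K u \<partial>lborel) = 0" by (rule integral_eq_zero_AE)
    with smoothing_kernel_integral[OF K] show False by simp
  qed
  moreover have "0 \<le> (\<integral>u. K u * u\<^sup>2 \<partial>lborel)"
    by (rule Bochner_Integration.integral_nonneg) (rule nn)
  ultimately show ?thesis by simp
qed

section \<open>Expectations of kernel weights and L^1 bounds for the averages\<close>

context poisson_sampling
begin

text \<open>Here f is the density of X, c its value at x and \<epsilon> its oscillation over the
  window. The bound on the absolute moment is the first claim applied to |k|. The second moment
  follows since a weight is at most B/h in absolute value, so its square is at most B/h times its
  absolute value: this is the origin of the variance order 1/(nh).\<close>

lemma expectation_rescale:
  assumes dens: "distributed M lborel X (\<lambda>y. ennreal (f y))" and f: "\<And>y. 0 \<le> f y"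
    and k: "compact_kernel k" and h: "0 < h"
    and near: "\<forall>y. \<bar>y - x\<bar> \<le> h \<longrightarrow> \<bar>f y - c\<bar> \<le> \<epsilon>"
  shows "\<bar>expectation (\<lambda>w. rescale k x h (X w)) - c * (\<integral>u. k u \<partial>lborel)\<bar> \<le> \<epsilon> * (\<integral>u. \<bar>k u\<bar> \<partial>lborel)"
    and "integrable M (\<lambda>w. rescale k x h (X w))"
    and "expectation (\<lambda>w. \<bar>rescale k x h (X w)\<bar>) \<le> (c + \<epsilon>) * (\<integral>u. \<bar>k u\<bar> \<partial>lborel)"
    and "(\<And>u. \<bar>k u\<bar> \<le> B) \<Longrightarrow> integrable M (\<lambda>w. (rescale k x h (X w))\<^sup>2)"
    and "(\<And>u. \<bar>k u\<bar> \<le> B) \<Longrightarrow>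
      expectation (\<lambda>w. (rescale k x h (X w))\<^sup>2) \<le> B * ((c + \<epsilon>) * (\<integral>u. \<bar>k u\<bar> \<partial>lborel)) / h"
proof -
  have fm: "f \<in> borel_measurable borel"
    using distributed_real_measurable[OF _ dens] f by simp
  have main: "\<bar>expectation (\<lambda>w. rescale g x h (X w)) - c * (\<integral>u. g u \<partial>lborel)\<bar> \<le> \<epsilon> * (\<integral>u. \<bar>g u\<bar> \<partial>lborel)"
    and int: "integrable M (\<lambda>w. rescale g x h (X w))" if g: "compact_kernel g" for g
  proof -
    have gm: "rescale g x h \<in> borel_measurable lborel" using rescale_measurable[OF g] by simp
    note avg = rescale_local_average[OF g h fm near]
    have "(\<integral>y. f y * rescale g x h y \<partial>lborel) = expectation (\<lambda>w. rescale g x h (X w))"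
      using f by (intro distributed_integral[OF dens gm]) auto
    with avg(2) show "\<bar>expectation (\<lambda>w. rescale g x h (X w)) - c * (\<integral>u. g u \<partial>lborel)\<bar> \<le> \<epsilon> * (\<integral>u. \<bar>g u\<bar> \<partial>lborel)"
      by simp
    show "integrable M (\<lambda>w. rescale g x h (X w))"
      using avg(1) distributed_integrable[OF dens gm] f by simp
  qed
  show "\<bar>expectation (\<lambda>w. rescale k x h (X w)) - c * (\<integral>u. k u \<partial>lborel)\<bar> \<le> \<epsilon> * (\<integral>u. \<bar>k u\<bar> \<partial>lborel)"
    "integrable M (\<lambda>w. rescale k x h (X w))"
    using main[OF k] int[OF k] by auto
  show abs: "expectation (\<lambda>w. \<bar>rescale k x h (X w)\<bar>) \<le> (c + \<epsilon>) * (\<integral>u. \<bar>k u\<bar> \<partial>lborel)"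
    using main[OF compact_kernel_abs[OF k]] unfolding rescale_abs[OF h] by (simp add: algebra_simps)
  assume B: "\<And>u. \<bar>k u\<bar> \<le> B"
  have [measurable]: "(\<lambda>w. rescale k x h (X w)) \<in> borel_measurable M"
    using rescale_measurable[OF k] by measurable
  have le: "(rescale k x h y)\<^sup>2 \<le> B / h * \<bar>rescale k x h y\<bar>" for y
  proof -
    have "\<bar>rescale k x h y\<bar> \<le> B / h"
      using B h by (simp add: rescale_def divide_right_mono)
    then have "\<bar>rescale k x h y\<bar> * \<bar>rescale k x h y\<bar> \<le> B / h * \<bar>rescale k x h y\<bar>"
      by (intro mult_right_mono) auto
    then show ?thesis by (simp add: power2_eq_square)
  qed
  have i1: "integrable M (\<lambda>w. B / h * \<bar>rescale k x h (X w)\<bar>)" using int[OF k] by simp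
  show i2: "integrable M (\<lambda>w. (rescale k x h (X w))\<^sup>2)"
  proof (rule Bochner_Integration.integrable_bound[OF i1])
    show "AE w in M. norm ((rescale k x h (X w))\<^sup>2) \<le> norm (B / h * \<bar>rescale k x h (X w)\<bar>)"
      by (intro AE_I2) (simp only: real_norm_def abs_power2, rule order_trans[OF le abs_ge_self])
  qed simp
  have "expectation (\<lambda>w. (rescale k x h (X w))\<^sup>2) \<le> expectation (\<lambda>w. B / h * \<bar>rescale k x h (X w)\<bar>)"
    by (intro integral_mono i1 i2 le)
  also have "\<dots> = B / h * expectation (\<lambda>w. \<bar>rescale k x h (X w)\<bar>)" by simp
  also have "\<dots> \<le> B / h * ((c + \<epsilon>) * (\<integral>u. \<bar>k u\<bar> \<partial>lborel))"
    using abs h B[of 0] by (intro mult_left_mono) auto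
  finally show "expectation (\<lambda>w. (rescale k x h (X w))\<^sup>2) \<le> B * ((c + \<epsilon>) * (\<integral>u. \<bar>k u\<bar> \<partial>lborel)) / h" by simp
qed

text \<open>The regression function is given only through a conditional expectation on the
  sigma-algebra generated by X. Testing it with bounded functions of X is how m replaces \<tau> in
  the bias.\<close>

lemma regression_expectation:
  assumes reg: "regression_function M X \<tau> m"
    and g: "g \<in> borel_measurable borel" and B: "\<And>y. \<bar>g y\<bar> \<le> B"
  shows "integrable M (\<lambda>w. g (X w) * m (X w))" "integrable M (\<lambda>w. g (X w) * \<tau> w)"
    and "expectation (\<lambda>w. g (X w) * \<tau> w) = expectation (\<lambda>w. g (X w) * m (X w))"
proof -
  let ?F = "vimage_algebra (space M) X borel"
  interpret F: finite_measure_subalgebra M ?F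
  proof
    show "subalgebra M ?F"
      unfolding subalgebra_def using measurable_sets[OF X_measurable] by (auto simp: sets_vimage_algebra2[of X "space M" borel])
  qed
  have X: "X \<in> borel_measurable ?F" by (rule measurable_vimage_algebra1) auto
  have gX: "(\<lambda>w. g (X w)) \<in> borel_measurable ?F" by (rule measurable_compose[OF X g])
  have m [measurable]: "m \<in> borel_measurable borel" and int: "integrable M \<tau>"
    and AE: "AE w in M. real_cond_exp M ?F \<tau> w = m (X w)"
    using reg by (auto simp: regression_function_def)
  have mX: "(\<lambda>w. m (X w)) \<in> borel_measurable M" by measurable
  have B': "AE w in M. \<bar>g (X w)\<bar> \<le> B" using B by simp
  note * = F.expectation_mult_cond_exp[OF gX B' int AE mX]
  show "integrable M (\<lambda>w. g (X w) * m (X w))" "integrable M (\<lambda>w. g (X w) * \<tau> w)"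
    "expectation (\<lambda>w. g (X w) * \<tau> w) = expectation (\<lambda>w. g (X w) * m (X w))"
    using * by auto
qed

text \<open>The two terms are the sampling fluctuation around the expectation and the smoothing bias
  of that expectation.\<close>

lemma expectation_abs_design_mean_le:
  assumes n: "1 \<le> n"
    and dens: "distributed M lborel X (\<lambda>y. ennreal (f y))" and f: "\<And>y. 0 \<le> f y"
    and k: "compact_kernel k" and B: "\<And>u. \<bar>k u\<bar> \<le> B" and h: "0 < h"
    and near: "\<forall>y. \<bar>y - x\<bar> \<le> h \<longrightarrow> \<bar>f y - c\<bar> \<le> \<epsilon>"
  shows "integrable M (\<lambda>w. (\<Sum>i=1..n. rescale k x h (Xs i w)) / real n - c * (\<integral>u. k u \<partial>lborel))"
    and "expectation (\<lambda>w. \<bar>(\<Sum>i=1..n. rescale k x h (Xs i w)) / real n - c * (\<integral>u. k u \<partial>lborel)\<bar>)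
      \<le> sqrt (B * ((c + \<epsilon>) * (\<integral>u. \<bar>k u\<bar> \<partial>lborel)) / h / real n) + \<epsilon> * (\<integral>u. \<bar>k u\<bar> \<partial>lborel)"
proof -
  note ker = expectation_rescale[OF dens f k h near]
  let ?S = "\<lambda>w. (\<Sum>i=1..n. rescale k x h (Xs i w)) / real n"
  let ?e = "expectation (\<lambda>w. rescale k x h (X w))" and ?c = "c * (\<integral>u. k u \<partial>lborel)"
  have \<phi>: "(\<lambda>p. rescale k x h (fst p)) \<in> borel_measurable (borel :: (real \<times> real) measure)"
    using rescale_measurable[OF k] unfolding borel_prod[symmetric] by measurable
  let ?v = "B * ((c + \<epsilon>) * (\<integral>u. \<bar>k u\<bar> \<partial>lborel)) / h"
  have mean: "integrable M (\<lambda>w. ?S w - ?e)" "expectation (\<lambda>w. \<bar>?S w - ?e\<bar>) \<le> sqrt (?v / real n)"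
    using expectation_abs_sample_mean_le[OF n \<phi>, of ?v] ker(4,5)[OF B] unfolding fst_conv by blast+
  have eq: "?S w - ?c = (?S w - ?e) + (?e - ?c)" for w by simp
  show int: "integrable M (\<lambda>w. ?S w - ?c)"
    by (subst eq, rule Bochner_Integration.integrable_add[OF mean(1) integrable_const])
  have "expectation (\<lambda>w. \<bar>?S w - ?c\<bar>) \<le> expectation (\<lambda>w. \<bar>?S w - ?e\<bar> + \<bar>?e - ?c\<bar>)"
    using int mean(1) by (intro integral_mono) auto
  also have "\<dots> = expectation (\<lambda>w. \<bar>?S w - ?e\<bar>) + \<bar>?e - ?c\<bar>"
    using mean(1) by (simp add: prob_space)
  finally show "expectation (\<lambda>w. \<bar>?S w - ?c\<bar>) \<le> sqrt (B * ((c + \<epsilon>) * (\<integral>u. \<bar>k u\<bar> \<partial>lborel)) / h / real n) + \<epsilon> * (\<integral>u. \<bar>k u\<bar> \<partial>lborel)"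
    using mean(2) ker(1) by linarith
qed

text \<open>The three terms are the Poisson noise, the fluctuation of the i.i.d. residuals of \<tau>
  from the line, and the bias of their mean. The number I bounds the first absolute moment of a
  kernel weight, and B I / h its second moment.\<close>

lemma expectation_abs_response_mean_le:
  assumes n: "1 \<le> n"
    and dens: "distributed M lborel X (\<lambda>y. ennreal (f y))" and f: "\<And>y. 0 \<le> f y"
    and k: "compact_kernel k" and B: "\<And>u. \<bar>k u\<bar> \<le> B" and h: "0 < h"
    and near: "\<forall>y. \<bar>y - x\<bar> \<le> h \<longrightarrow> \<bar>f y - c\<bar> \<le> \<epsilon>"
    and reg: "regression_function M X \<tau> m"
    and taylor: "\<forall>y. \<bar>y - x\<bar> \<le> h \<longrightarrow> \<bar>m y - (a + d * (y - x))\<bar> \<le> R"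
  defines "I \<equiv> (c + \<epsilon>) * (\<integral>u. \<bar>k u\<bar> \<partial>lborel)"
  shows "integrable M (\<lambda>w. (\<Sum>i=1..n. rescale k x h (Xs i w) *
      (real (N n i w T) / \<alpha> n - (a + d * (Xs i w - x)))) / real n)"
    and "expectation (\<lambda>w. \<bar>(\<Sum>i=1..n. rescale k x h (Xs i w) *
      (real (N n i w T) / \<alpha> n - (a + d * (Xs i w - x)))) / real n\<bar>)
      \<le> sqrt (b * (B * I / h) / \<alpha> n / real n)
        + sqrt ((b + \<bar>a\<bar> + \<bar>d\<bar> * h)\<^sup>2 * (B * I / h) / real n) + R * I"
proof -
  let ?w = "rescale k x h" and ?V = "B * I / h" and ?Q = "b + \<bar>a\<bar> + \<bar>d\<bar> * h"
  define \<phi> where "\<phi> p = ?w (fst p) * (snd p - (a + d * (fst p - x)))" for p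
  note ker = expectation_rescale[OF dens f k h near, folded I_def]
  note [measurable] = rescale_measurable[OF k, of x h]
  have \<alpha>: "0 < \<alpha> n" by (rule \<alpha>_pos[OF n])
  have \<phi> [measurable]: "\<phi> \<in> borel_measurable (borel :: (real \<times> real) measure)"
    unfolding \<phi>_def borel_prod[symmetric] by measurable
  have wB: "\<bar>?w y\<bar> \<le> B / h" for y
    using B h by (simp add: rescale_def divide_right_mono)
  \<comment> \<open>A bound uniform in y, although the line is unbounded: the weight vanishes
    outside the window. It makes the linear part integrable without any moment of X.\<close>
  have lin: "\<bar>?w y * (a + d * (y - x))\<bar> \<le> B / h * (\<bar>a\<bar> + \<bar>d\<bar> * h)" for y
  proof (cases "\<bar>y - x\<bar> \<le> h")
    case True
    then have "\<bar>d * (y - x)\<bar> \<le> \<bar>d\<bar> * h" by (simp add: abs_mult mult_left_mono)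
    then have "\<bar>?w y\<bar> * \<bar>a + d * (y - x)\<bar> \<le> B / h * (\<bar>a\<bar> + \<bar>d\<bar> * h)"
      using wB[of y] by (intro mult_mono) auto
    then show ?thesis by (simp add: abs_mult)
  next
    case False
    then have w0: "?w y = 0" using rescale_eq_0[OF k h, of y x] by simp
    have "0 \<le> B / h" using wB[of x] by linarith
    then have "0 \<le> B / h * (\<bar>a\<bar> + \<bar>d\<bar> * h)" using h by (intro mult_nonneg_nonneg) auto
    then show ?thesis unfolding w0 by simp
  qed
  have \<phi>Q: "AE w in M. (\<phi> (X w, \<tau> w))\<^sup>2 \<le> ?Q\<^sup>2 * (?w (X w))\<^sup>2"
    using mass_bounds
  proof eventually_elim
    case (elim w)
    have "\<bar>\<phi> (X w, \<tau> w)\<bar> \<le> ?Q * \<bar>?w (X w)\<bar>"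
    proof (cases "\<bar>X w - x\<bar> \<le> h")
      case True
      then have "\<bar>d * (X w - x)\<bar> \<le> \<bar>d\<bar> * h" by (simp add: abs_mult mult_left_mono)
      moreover have "\<bar>t - (a + z)\<bar> \<le> b + \<bar>a\<bar> + q" if "\<bar>z\<bar> \<le> q" "0 \<le> t" "t \<le> b" for t z q
        using that by linarith
      ultimately have "\<bar>\<tau> w - (a + d * (X w - x))\<bar> \<le> ?Q"
        using elim by (simp add: \<tau>_def)
      then have "\<bar>\<tau> w - (a + d * (X w - x))\<bar> * \<bar>?w (X w)\<bar> \<le> ?Q * \<bar>?w (X w)\<bar>"
        by (rule mult_right_mono) simp
      then show ?thesis by (simp add: \<phi>_def abs_mult mult.commute)
    next
      case False
      then show ?thesis using rescale_eq_0[OF k h, of "X w" x] by (simp add: \<phi>_def)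
    qed
    then have "\<bar>\<phi> (X w, \<tau> w)\<bar>\<^sup>2 \<le> (?Q * \<bar>?w (X w)\<bar>)\<^sup>2" by (intro power_mono) auto
    then show ?case by (simp add: power_mult_distrib)
  qed
  have \<phi>M [measurable]: "(\<lambda>w. \<phi> (X w, \<tau> w)) \<in> borel_measurable M"
    by (rule measurable_compose[OF covariate_mass \<phi>])
  have iQ: "integrable M (\<lambda>w. ?Q\<^sup>2 * (?w (X w))\<^sup>2)" using ker(4)[OF B] by simp
  have sq: "integrable M (\<lambda>w. (\<phi> (X w, \<tau> w))\<^sup>2)"
    by (rule Bochner_Integration.integrable_bound[OF iQ]) (use \<phi>Q in auto)
  have "expectation (\<lambda>w. (\<phi> (X w, \<tau> w))\<^sup>2) \<le> expectation (\<lambda>w. ?Q\<^sup>2 * (?w (X w))\<^sup>2)"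
    by (rule integral_mono_AE[OF sq iQ \<phi>Q])
  also have "\<dots> = ?Q\<^sup>2 * expectation (\<lambda>w. (?w (X w))\<^sup>2)" by simp
  also have "\<dots> \<le> ?Q\<^sup>2 * ?V" by (rule mult_left_mono[OF ker(5)[OF B]]) simp
  finally have v: "expectation (\<lambda>w. (\<phi> (X w, \<tau> w))\<^sup>2) \<le> ?Q\<^sup>2 * ?V" .
  let ?e = "expectation (\<lambda>w. \<phi> (X w, \<tau> w))"
  \<comment> \<open>The bias: \<tau> is replaced by m(X) under the expectation, and on the window m
    differs from the line by at most R.\<close>
  have e: "\<bar>?e\<bar> \<le> R * I"
  proof -
    note re = regression_expectation[OF reg rescale_measurable[OF k] wB]
    have il: "integrable M (\<lambda>w. ?w (X w) * (a + d * (X w - x)))"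
      by (rule integrable_const_bound[where B="B / h * (\<bar>a\<bar> + \<bar>d\<bar> * h)"]) (use lin in auto)
    have "?e = expectation (\<lambda>w. ?w (X w) * \<tau> w) - expectation (\<lambda>w. ?w (X w) * (a + d * (X w - x)))"
      using re(2) il by (simp add: \<phi>_def right_diff_distrib)
    also have "\<dots> = expectation (\<lambda>w. ?w (X w) * m (X w) - ?w (X w) * (a + d * (X w - x)))"
      unfolding re(3) using re(1) il by simp
    finally have e: "?e = expectation (\<lambda>w. ?w (X w) * m (X w) - ?w (X w) * (a + d * (X w - x)))" .
    have "\<bar>?e\<bar> \<le> expectation (\<lambda>w. R * \<bar>?w (X w)\<bar>)"
      unfolding e
    proof (rule order_trans[OF integral_abs_bound], rule integral_mono)
      fix w
      have "\<bar>m (X w) - (a + d * (X w - x))\<bar> * \<bar>?w (X w)\<bar> \<le> R * \<bar>?w (X w)\<bar>"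
        using taylor rescale_eq_0[OF k h, of "X w" x]
        by (cases "\<bar>X w - x\<bar> \<le> h") (auto intro: mult_right_mono)
      then have "\<bar>(m (X w) - (a + d * (X w - x))) * ?w (X w)\<bar> \<le> R * \<bar>?w (X w)\<bar>"
        by (simp only: abs_mult)
      moreover have "?w (X w) * m (X w) - ?w (X w) * (a + d * (X w - x)) = (m (X w) - (a + d * (X w - x))) * ?w (X w)"
        by (simp add: algebra_simps)
      ultimately show "\<bar>?w (X w) * m (X w) - ?w (X w) * (a + d * (X w - x))\<bar> \<le> R * \<bar>?w (X w)\<bar>"
        by (simp only:)
    qed (use re(1) il ker(2) in auto)
    also have "\<dots> = R * expectation (\<lambda>w. \<bar>?w (X w)\<bar>)" by simp
    \<comment> \<open>The Taylor bound at y = x shows that R is nonnegative, which the monotonicity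
      step requires.\<close>
    also have "\<dots> \<le> R * I"
      using ker(3) taylor[rule_format, of x] h by (intro mult_left_mono) auto
    finally show ?thesis .
  qed
  let ?S = "\<lambda>w. (\<Sum>i=1..n. \<phi> (Xs i w, \<tau>s i w)) / real n"
  let ?E = "\<lambda>w. (\<Sum>i=1..n. ?w (Xs i w) * noise n i w) / real n"
  let ?D = "\<lambda>w. (\<Sum>i=1..n. ?w (Xs i w) * (real (N n i w T) / \<alpha> n - (a + d * (Xs i w - x)))) / real n"
  note mean = expectation_abs_sample_mean_le[OF n \<phi> sq v]
  note noise = expectation_abs_noise_mean_le[OF n rescale_measurable[OF k] wB]
  \<comment> \<open>A normalised count is \<tau> plus noise, so the average separates into weighted
    noise, centred sample mean and bias.\<close>
  have split: "?D w = ?E w + (?S w - ?e) + ?e" for w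
    by (simp add: \<phi>_def noise_def add_divide_distrib[symmetric] sum.distrib[symmetric] algebra_simps)
  show int: "integrable M ?D"
    by (subst split) (intro Bochner_Integration.integrable_add mean(1) noise(1) integrable_const)
  have "expectation (\<lambda>w. \<bar>?D w\<bar>) \<le> expectation (\<lambda>w. \<bar>?E w\<bar> + \<bar>?S w - ?e\<bar> + \<bar>?e\<bar>)"
  proof (rule integral_mono)
    show "\<bar>?D w\<bar> \<le> \<bar>?E w\<bar> + \<bar>?S w - ?e\<bar> + \<bar>?e\<bar>" for w unfolding split by linarith
  qed (intro Bochner_Integration.integrable_add integrable_abs mean(1) noise(1) integrable_const int)+
  also have "\<dots> = expectation (\<lambda>w. \<bar>?E w\<bar>) + expectation (\<lambda>w. \<bar>?S w - ?e\<bar>) + \<bar>?e\<bar>"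
    using integrable_abs[OF mean(1)] integrable_abs[OF noise(1)]
    by (simp add: prob_space Bochner_Integration.integrable_add Bochner_Integration.integral_add)
  also have "\<dots> \<le> sqrt (b * ?V / \<alpha> n / real n) + sqrt (?Q\<^sup>2 * ?V / real n) + R * I"
  proof (intro add_mono e mean(2))
    have "sqrt (b * expectation (\<lambda>w. (?w (X w))\<^sup>2) / \<alpha> n / real n) \<le> sqrt (b * ?V / \<alpha> n / real n)"
      using ker(5)[OF B] b_nonneg \<alpha> by (intro real_sqrt_le_mono divide_right_mono mult_left_mono) auto
    with noise(2) show "expectation (\<lambda>w. \<bar>?E w\<bar>) \<le> sqrt (b * ?V / \<alpha> n / real n)" by linarith
  qed
  finally show "expectation (\<lambda>w. \<bar>?D w\<bar>) \<le> sqrt (b * ?V / \<alpha> n / real n) + sqrt (?Q\<^sup>2 * ?V / real n) + R * I" .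
qed

text \<open>The same splitting with constant weight 1: without smoothing there is neither a bias
  term nor a factor 1/h.\<close>

lemma expectation_abs_mean_count_le:
  assumes n: "1 \<le> n"
  shows "integrable M (\<lambda>w. (\<Sum>i=1..n. real (N n i w T) / \<alpha> n) / real n - expectation \<tau>)"
    and "expectation (\<lambda>w. \<bar>(\<Sum>i=1..n. real (N n i w T) / \<alpha> n) / real n - expectation \<tau>\<bar>)
      \<le> sqrt (b / \<alpha> n / real n) + sqrt (b\<^sup>2 / real n)"
proof -
  have snd: "snd \<in> borel_measurable (borel :: (real \<times> real) measure)"
    unfolding borel_prod[symmetric] by measurable
  have le: "AE w in M. (\<tau> w)\<^sup>2 \<le> b\<^sup>2"
    using mass_bounds by eventually_elim (auto simp: \<tau>_def intro: power_mono)
  have sq: "integrable M (\<lambda>w. (snd (X w, \<tau> w))\<^sup>2)"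
    by (rule integrable_const_bound[where B="b\<^sup>2"]) (use le in auto)
  have v: "expectation (\<lambda>w. (snd (X w, \<tau> w))\<^sup>2) \<le> b\<^sup>2"
    using integral_mono_AE[OF sq integrable_const] le by (simp add: prob_space)
  note mean = expectation_abs_sample_mean_le[OF n snd sq v, unfolded snd_conv]
  have noise: "integrable M (\<lambda>w. (\<Sum>i=1..n. noise n i w) / real n)"
    "expectation (\<lambda>w. \<bar>(\<Sum>i=1..n. noise n i w) / real n\<bar>) \<le> sqrt (b / \<alpha> n / real n)"
    using expectation_abs_noise_mean_le[OF n, of "\<lambda>_. 1" 1] by (simp_all add: prob_space)
  let ?S = "\<lambda>w. (\<Sum>i=1..n. \<tau>s i w) / real n - expectation \<tau>"
  let ?E = "\<lambda>w. (\<Sum>i=1..n. noise n i w) / real n"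
  have split: "(\<Sum>i=1..n. real (N n i w T) / \<alpha> n) / real n - expectation \<tau> = ?E w + ?S w" for w
    by (simp add: noise_def add_divide_distrib[symmetric] sum.distrib[symmetric])
  show "integrable M (\<lambda>w. (\<Sum>i=1..n. real (N n i w T) / \<alpha> n) / real n - expectation \<tau>)"
    unfolding split by (intro Bochner_Integration.integrable_add mean(1) noise(1))
  have "expectation (\<lambda>w. \<bar>?E w + ?S w\<bar>) \<le> expectation (\<lambda>w. \<bar>?E w\<bar> + \<bar>?S w\<bar>)"
    by (intro integral_mono Bochner_Integration.integrable_add integrable_abs mean(1) noise(1) abs_triangle_ineq)
  also have "\<dots> = expectation (\<lambda>w. \<bar>?E w\<bar>) + expectation (\<lambda>w. \<bar>?S w\<bar>)"
    by (intro Bochner_Integration.integral_add integrable_abs mean(1) noise(1))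
  finally show "expectation (\<lambda>w. \<bar>(\<Sum>i=1..n. real (N n i w T) / \<alpha> n) / real n - expectation \<tau>\<bar>)
      \<le> sqrt (b / \<alpha> n / real n) + sqrt (b\<^sup>2 / real n)"
    unfolding split using mean(2) noise(2) by linarith
qed

end

section \<open>The local linear estimator\<close>

text \<open>The deterministic core. Near the limits f, 0, f s, \<mu> of U0, U1, U2, B both
  denominators are bounded away from 0, and the error is then linear in D0, D1 and B - \<mu>.
  Deviations of the U's decide whether the bound applies but do not appear in it.\<close>

lemma local_linear_ratio_bound:
  fixes f s \<mu> a :: real
  assumes "0 < f" "0 < s" "0 < \<mu>"
  obtains \<eta> C where "0 < \<eta>" "0 < C"
    and "\<And>U0 U1 U2 D0 D1 B. \<bar>U0 - f\<bar> + \<bar>U1\<bar> + \<bar>U2 - f * s\<bar> + \<bar>B - \<mu>\<bar> < \<eta> \<Longrightarrow> 0 < U0 * U2 - U1\<^sup>2 \<and>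
      \<bar>max 0 ((a + (U2 * D0 - U1 * D1) / (U0 * U2 - U1\<^sup>2)) / B) - max a 0 / \<mu>\<bar>
        \<le> C * (\<bar>D0\<bar> + \<bar>D1\<bar> + \<bar>B - \<mu>\<bar>)"
proof -
  \<comment> \<open>With U0 at least f/2 and U2 at least f s/2, the product is at least f^2 s/4; the
    bound \<open>sqrt d\<close> on U1 takes away at most half of this, so d is a lower bound for the
    determinant. The constant C1 combines |U1|, |U2| at most 2 f s, the determinant at least d and B
    at least \<mu>/2; C2 bounds the effect of replacing B by \<mu>.\<close>
  define d where "d = f\<^sup>2 * s / 8"
  define \<eta> where "\<eta> = min (f / 2) (min (f * s / 2) (min (\<mu> / 2) (sqrt d)))"
  define C1 where "C1 = 2 * f * s / d * (2 / \<mu>)"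
  define C2 where "C2 = 2 * \<bar>a\<bar> / \<mu>\<^sup>2"
  have d: "0 < d" using assms by (simp add: d_def)
  have \<eta>: "0 < \<eta>" using assms d by (simp add: \<eta>_def)
  have C1: "0 < C1" using assms d by (simp add: C1_def)
  have C2: "0 \<le> C2" by (simp add: C2_def)
  have fs: "0 < f * s" using assms by simp
  show thesis
  proof (rule that[OF \<eta>, of "C1 + C2"])
    show "0 < C1 + C2" using C1 C2 by simp
    fix U0 U1 U2 D0 D1 B :: real
    assume close: "\<bar>U0 - f\<bar> + \<bar>U1\<bar> + \<bar>U2 - f * s\<bar> + \<bar>B - \<mu>\<bar> < \<eta>"
    have le: "\<eta> \<le> f / 2" "\<eta> \<le> f * s / 2" "\<eta> \<le> \<mu> / 2" "\<eta> \<le> sqrt d" by (simp_all add: \<eta>_def)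
    have U0: "f / 2 \<le> U0" and U2: "f * s / 2 \<le> U2" "\<bar>U2\<bar> \<le> 2 * (f * s)" and U1: "\<bar>U1\<bar> \<le> 2 * (f * s)" "\<bar>U1\<bar> \<le> sqrt d"
      and B: "\<mu> / 2 \<le> B"
      using close le fs by linarith+
    have "(f / 2) * (f * s / 2) \<le> U0 * U2"
      using U0 U2 assms by (intro mult_mono) auto
    moreover have "U1\<^sup>2 \<le> d" using power_mono[OF U1(2), of 2] d by simp
    ultimately have \<Delta>: "d \<le> U0 * U2 - U1\<^sup>2" by (simp add: d_def power2_eq_square)
    let ?\<Delta> = "U0 * U2 - U1\<^sup>2"
    let ?E = "(U2 * D0 - U1 * D1) / ?\<Delta>"
    have "\<bar>U2 * D0 - U1 * D1\<bar> \<le> \<bar>U2\<bar> * \<bar>D0\<bar> + \<bar>U1\<bar> * \<bar>D1\<bar>"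
      by (simp add: abs_mult[symmetric])
    also have "\<dots> \<le> 2 * (f * s) * \<bar>D0\<bar> + 2 * (f * s) * \<bar>D1\<bar>"
      using U2 U1 by (intro add_mono mult_right_mono) auto
    finally have num: "\<bar>U2 * D0 - U1 * D1\<bar> \<le> 2 * f * s * (\<bar>D0\<bar> + \<bar>D1\<bar>)" by (simp add: algebra_simps)
    have E: "\<bar>?E\<bar> \<le> 2 * f * s * (\<bar>D0\<bar> + \<bar>D1\<bar>) / d"
      unfolding abs_divide using num \<Delta> d by (intro frac_le) auto
    have nonneg: "0 \<le> 2 * f * s * (\<bar>D0\<bar> + \<bar>D1\<bar>) / d"
      using assms d by simp
    have B0: "0 < B" using B assms by linarith
    \<comment> \<open>The error of the numerator is separated from that of the denominator.\<close>
    have "(a + e) / B - a / \<mu> = e / B + a * (\<mu> - B) / (B * \<mu>)" for e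
      using B0 assms by (simp add: field_simps)
    then have "\<bar>(a + ?E) / B - a / \<mu>\<bar> \<le> \<bar>?E / B\<bar> + \<bar>a * (\<mu> - B) / (B * \<mu>)\<bar>"
      by (simp only: abs_triangle_ineq)
    also have "\<bar>?E / B\<bar> \<le> (2 * f * s * (\<bar>D0\<bar> + \<bar>D1\<bar>) / d) / (\<mu> / 2)"
      unfolding abs_divide[of ?E B] using E B B0 assms nonneg by (intro frac_le) auto
    also have "\<dots> = C1 * (\<bar>D0\<bar> + \<bar>D1\<bar>)" using d assms by (simp add: C1_def field_simps)
    also have "\<bar>a * (\<mu> - B) / (B * \<mu>)\<bar> \<le> \<bar>a\<bar> * \<bar>B - \<mu>\<bar> / (\<mu> / 2 * \<mu>)"
      unfolding abs_divide abs_mult using B B0 assms by (intro frac_le mult_mono) (auto simp: abs_minus_commute)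
    also have "\<dots> = C2 * \<bar>B - \<mu>\<bar>" using assms by (simp add: C2_def power2_eq_square field_simps)
    also have "C1 * (\<bar>D0\<bar> + \<bar>D1\<bar>) + C2 * \<bar>B - \<mu>\<bar> \<le> (C1 + C2) * (\<bar>D0\<bar> + \<bar>D1\<bar> + \<bar>B - \<mu>\<bar>)"
    proof -
      have "0 \<le> C2 * (\<bar>D0\<bar> + \<bar>D1\<bar>) + C1 * \<bar>B - \<mu>\<bar>" using C1 C2 by simp
      then show ?thesis by (simp add: algebra_simps)
    qed
    finally have main: "\<bar>(a + ?E) / B - a / \<mu>\<bar> \<le> (C1 + C2) * (\<bar>D0\<bar> + \<bar>D1\<bar> + \<bar>B - \<mu>\<bar>)" by simp
    have max: "max a 0 / \<mu> = max 0 (a / \<mu>)" using assms by (auto simp: max_def field_simps)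
    \<comment> \<open>Truncation at 0 is 1-Lipschitz and commutes with division by the positive
      \<mu>, so it does not enlarge the error.\<close>
    have "\<bar>max 0 p - max 0 q\<bar> \<le> \<bar>p - q\<bar>" for p q :: real by (simp add: max_def)
    then have "\<bar>max 0 ((a + ?E) / B) - max a 0 / \<mu>\<bar> \<le> \<bar>(a + ?E) / B - a / \<mu>\<bar>" unfolding max .
    with main \<Delta> d show "0 < ?\<Delta> \<and> \<bar>max 0 ((a + ?E) / B) - max a 0 / \<mu>\<bar> \<le> (C1 + C2) * (\<bar>D0\<bar> + \<bar>D1\<bar> + \<bar>B - \<mu>\<bar>)"
      by linarith
  qed
qed

text \<open>The line \<open>a + d * (y - x)\<close> is arbitrary: the local linear weights average the constant 1 to 1 and \<open>y - x\<close> to 0.\<close>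
lemma tau_tilde_eq:
  fixes K :: "real \<Rightarrow> real" and xs :: "nat \<Rightarrow> real" and c :: "nat \<Rightarrow> nat" and x h a d \<alpha> :: real
  assumes h: "0 < h" and \<alpha>: "0 < \<alpha>" and n: "1 \<le> n"
  defines "U \<equiv> \<lambda>j. (\<Sum>i=1..n. rescale (\<lambda>u. K u * u ^ j) x h (xs i)) / real n"
    and "D \<equiv> \<lambda>j. (\<Sum>i=1..n. rescale (\<lambda>u. K u * u ^ j) x h (xs i) *
      (real (c i) / \<alpha> - (a + d * (xs i - x)))) / real n"
  assumes \<Delta>: "U 0 * U 2 - (U 1)\<^sup>2 \<noteq> 0"
  shows "tau_tilde K h x n xs c =
    max 0 ((a + (U 2 * D 0 - U 1 * D 1) / (U 0 * U 2 - (U 1)\<^sup>2)) / ((\<Sum>i=1..n. real (c i) / \<alpha>) / real n))"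
proof -
  let ?w = "\<lambda>j i. rescale (\<lambda>u. K u * u ^ j) x h (xs i)"
  let ?\<Delta> = "U 0 * U 2 - (U 1)\<^sup>2"
  define S where "S j = (\<Sum>i=1..n. ?w j i * (real (c i) / \<alpha>)) / real n" for j
  \<comment> \<open>The powers of h are taken out here; in the weights they cancel against the
    factor \<open>h\<^sup>2\<close> of the determinant.\<close>
  have wj: "K_scaled K h (xs i - x) * (xs i - x) ^ j = h ^ j * ?w j i" for i j
    using h by (simp add: K_scaled_def rescale_def power_divide)
  have u: "u_hat K h x n xs j = h ^ j * U j" for j
    unfolding u_hat_def U_def wj by (simp add: sum_distrib_left)
  have \<sigma>: "sigma0_sq_hat K h x n xs = h\<^sup>2 * ?\<Delta>"
    unfolding sigma0_sq_hat_def u by (simp add: power2_eq_square algebra_simps)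
  have s: "s_weight K h x n xs i = (U 2 * ?w 0 i - U 1 * ?w 1 i) / ?\<Delta>" for i
  proof -
    have "K_scaled K h (xs i - x) * (u_hat K h x n xs 2 - u_hat K h x n xs 1 * (xs i - x))
      = h\<^sup>2 * U 2 * (K_scaled K h (xs i - x) * (xs i - x) ^ 0)
        - h * U 1 * (K_scaled K h (xs i - x) * (xs i - x) ^ 1)"
      unfolding u by (simp add: algebra_simps)
    also have "\<dots> = h\<^sup>2 * (U 2 * ?w 0 i - U 1 * ?w 1 i)"
      unfolding wj by (simp add: algebra_simps power2_eq_square)
    finally show ?thesis using h by (simp add: s_weight_def \<sigma>)
  qed
  have num: "(\<Sum>i=1..n. s_weight K h x n xs i * real (c i)) / real n = \<alpha> * ((U 2 * S 0 - U 1 * S 1) / ?\<Delta>)"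
  proof -
    have "s_weight K h x n xs i * real (c i)
      = \<alpha> / ?\<Delta> * (U 2 * (?w 0 i * (real (c i) / \<alpha>)) - U 1 * (?w 1 i * (real (c i) / \<alpha>)))" for i
      unfolding s using \<alpha> \<Delta> by (simp add: field_simps)
    then have "(\<Sum>i=1..n. s_weight K h x n xs i * real (c i))
      = \<alpha> / ?\<Delta> * (U 2 * (\<Sum>i=1..n. ?w 0 i * (real (c i) / \<alpha>)) - U 1 * (\<Sum>i=1..n. ?w 1 i * (real (c i) / \<alpha>)))"
      by (simp only: sum_distrib_left[symmetric] sum_subtractf)
    moreover have "\<alpha> / \<Delta> * (u * P - v * Q) / r = \<alpha> * ((u * (P / r) - v * (Q / r)) / \<Delta>)" for \<Delta> u v P Q r :: real
      by (simp add: diff_divide_distrib right_diff_distrib mult_ac)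
    ultimately show ?thesis unfolding S_def by (simp only:)
  qed
  \<comment> \<open>Multiplying a weight by X_i - x raises its index j by one and costs a factor h,
    so the slope of the line produces the next moment \<open>U (Suc j)\<close>.\<close>
  have DS: "D j = S j - a * U j - d * h * U (Suc j)" for j
  proof -
    have "?w j i * (real (c i) / \<alpha> - (a + d * (xs i - x)))
      = ?w j i * (real (c i) / \<alpha>) - a * ?w j i - d * h * ?w (Suc j) i" for i
    proof -
      have "d * h * ?w (Suc j) i = d * (?w j i * (xs i - x))"
        using h by (simp add: rescale_def)
      then show ?thesis by (simp only:) (simp add: algebra_simps)
    qed
    then have "(\<Sum>i=1..n. ?w j i * (real (c i) / \<alpha> - (a + d * (xs i - x))))
      = (\<Sum>i=1..n. ?w j i * (real (c i) / \<alpha>)) - a * (\<Sum>i=1..n. ?w j i) - d * h * (\<Sum>i=1..n. ?w (Suc j) i)"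
      by (simp only: sum_distrib_left[symmetric] sum_subtractf)
    then show ?thesis unfolding D_def S_def U_def by (simp add: diff_divide_distrib)
  qed
  \<comment> \<open>The slope contributes d h (U 2 U 1 - U 1 U 2) = 0, and the constant a
    contributes exactly a times the determinant.\<close>
  have "U 2 * S 0 - U 1 * S 1 = a * ?\<Delta> + (U 2 * D 0 - U 1 * D 1)"
    unfolding DS by (simp add: numeral_2_eq_2 power2_eq_square algebra_simps)
  then have ratio: "(U 2 * S 0 - U 1 * S 1) / ?\<Delta> = a + (U 2 * D 0 - U 1 * D 1) / ?\<Delta>"
    using \<Delta> by (simp add: add_divide_distrib)
  have den: "(\<Sum>i=1..n. real (c i)) / real n = \<alpha> * ((\<Sum>i=1..n. real (c i) / \<alpha>) / real n)"
    using \<alpha> by (simp add: sum_divide_distrib[symmetric])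
  show ?thesis
    unfolding tau_tilde_def num ratio den using \<alpha> by simp
qed

section \<open>Rates\<close>

text \<open>Markov's inequality is used twice. V controls the exceptional event, outside of which Z
  is dominated by W, and only needs to tend to 0 in mean; W carries the rate. On the exceptional
  event Z may be arbitrary.\<close>

lemma (in prob_space) bigO_prob_from_moments:
  fixes Z V W :: "nat \<Rightarrow> 'a \<Rightarrow> real"
  assumes Z: "\<And>n. 1 \<le> n \<Longrightarrow> Z n \<in> borel_measurable M"
    and V: "\<And>e. 0 < e \<Longrightarrow> \<forall>\<^sub>F n in sequentially. integrable M (V n) \<and> expectation (V n) \<le> e"
    and W: "\<forall>\<^sub>F n in sequentially. integrable M (W n) \<and> expectation (W n) \<le> C * r n"
    and nonneg: "\<And>n w. 0 \<le> V n w" "\<And>n w. 0 \<le> W n w"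
    and r: "\<And>n. 1 \<le> n \<Longrightarrow> 0 < r n"
    and \<eta>: "0 < \<eta>" and C': "0 < C'"
    and dom: "\<forall>\<^sub>F n in sequentially. \<forall>w\<in>space M. V n w < \<eta> \<longrightarrow> \<bar>Z n w\<bar> \<le> C' * W n w"
  shows "bigO_prob M Z r"
  unfolding bigO_prob_def
proof (intro conjI allI impI)
  fix \<epsilon> :: real assume \<epsilon>: "0 < \<epsilon>"
  \<comment> \<open>Chosen so that Markov's bound for W comes out as \<epsilon>/2; the other half is
    spent on V. Using |C| + 1 keeps D positive whatever the sign of C.\<close>
  define D where "D = 2 * C' * (\<bar>C\<bar> + 1) / \<epsilon>"
  have D: "0 < D" using \<epsilon> C' by (simp add: D_def)
  have "\<forall>\<^sub>F n in sequentially. integrable M (V n) \<and> expectation (V n) \<le> \<eta> * \<epsilon> / 2"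
    using \<eta> \<epsilon> by (intro V) simp
  then have "\<forall>\<^sub>F n in sequentially. prob {w \<in> space M. \<bar>Z n w\<bar> > D * r n} \<le> \<epsilon>"
    using W dom eventually_ge_at_top[of 1]
  proof eventually_elim
    case (elim n)
    have [measurable]: "Z n \<in> borel_measurable M" "V n \<in> borel_measurable M" "W n \<in> borel_measurable M"
      using elim Z by auto
    have rn: "0 < r n" using elim r by simp
    define t where "t = D * r n / C'"
    have t: "0 < t" using D rn C' by (simp add: t_def)
    have "{w \<in> space M. \<bar>Z n w\<bar> > D * r n} \<subseteq> {w \<in> space M. V n w \<ge> \<eta>} \<union> {w \<in> space M. W n w \<ge> t}"
    proof
      fix w assume w: "w \<in> {w \<in> space M. \<bar>Z n w\<bar> > D * r n}"
      show "w \<in> {w \<in> space M. V n w \<ge> \<eta>} \<union> {w \<in> space M. W n w \<ge> t}"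
      proof (cases "V n w < \<eta>")
        case True
        with w elim(3) have "D * r n \<le> C' * W n w" by fastforce
        then have "t \<le> W n w" using C' by (simp add: t_def field_simps)
        with w show ?thesis by simp
      qed (use w in auto)
    qed
    then have "prob {w \<in> space M. \<bar>Z n w\<bar> > D * r n}
      \<le> prob ({w \<in> space M. V n w \<ge> \<eta>} \<union> {w \<in> space M. W n w \<ge> t})"
      by (rule finite_measure_mono) measurable
    also have "\<dots> \<le> prob {w \<in> space M. V n w \<ge> \<eta>} + prob {w \<in> space M. W n w \<ge> t}"
      by (rule measure_Un_le) measurable
    also have "prob {w \<in> space M. V n w \<ge> \<eta>} \<le> expectation (V n) / \<eta>"
      using elim nonneg \<eta> by (intro integral_Markov_inequality_measure[of _ _ "{}"]) auto
    also have "\<dots> \<le> \<epsilon> / 2" using elim(1) \<eta> by (simp add: field_simps)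
    also have "prob {w \<in> space M. W n w \<ge> t} \<le> expectation (W n) / t"
      using elim nonneg t by (intro integral_Markov_inequality_measure[of _ _ "{}"]) auto
    also have "\<dots> \<le> (\<bar>C\<bar> + 1) * r n / t"
    proof (rule divide_right_mono)
      have "C * r n \<le> (\<bar>C\<bar> + 1) * r n" using rn by (intro mult_right_mono) auto
      then show "expectation (W n) \<le> (\<bar>C\<bar> + 1) * r n" using elim(2) by linarith
    qed (use t in simp)
    also have "\<dots> = \<epsilon> / 2"
    proof -
      have "c * r n / (2 * C' * c / \<epsilon> * r n / C') = \<epsilon> / 2" if "0 < c" for c
        using that rn C' \<epsilon> by simp
      from this[of "\<bar>C\<bar> + 1"] show ?thesis unfolding t_def D_def by simp
    qed
    finally show ?case by simp
  qed
  then show "\<exists>C>0. \<forall>\<^sub>F n in sequentially. prob {w \<in> space M. \<bar>Z n w\<bar> > C * r n} \<le> \<epsilon>"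
    using D by blast
qed (use Z in auto)

lemma sqrt_mult_square: "0 \<le> r \<Longrightarrow> sqrt (c * r\<^sup>2) = sqrt c * r"
  by (simp add: real_sqrt_mult)

text \<open>The exponents satisfy -1/5 + 1 - 4/5 = 0, which makes 1/(nh) a multiple of the squared
  rate. Writing it as a square lets the rate leave the square roots in the variance bounds.\<close>

lemma bandwidth_rate:
  assumes n: "1 \<le> n" and c0: "0 < c0" and h: "h = c0 * real n powr (- 1/5)"
  shows "h\<^sup>2 = c0\<^sup>2 * real n powr (- 2/5)"
    and "W / h / real n = W / c0 * (real n powr (- 2/5))\<^sup>2"
proof -
  have p: "0 < real n" using n by simp
  have "(real n powr (- 1/5))\<^sup>2 = real n powr (- 2/5)"
    by (simp add: power2_eq_square flip: powr_add)
  then show "h\<^sup>2 = c0\<^sup>2 * real n powr (- 2/5)"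
    unfolding h by (simp add: power_mult_distrib)
  have "real n powr (- 1/5) * real n * (real n powr (- 2/5))\<^sup>2
    = real n powr (- 1/5) * real n powr 1 * (real n powr (- 2/5) * real n powr (- 2/5))"
    using p by (simp add: power2_eq_square)
  also have "\<dots> = real n powr (- 1/5 + 1 + (- 2/5 + - 2/5))" by (simp only: powr_add)
  also have "\<dots> = 1" using p by simp
  finally have "1 = real n powr (- 1/5) * real n * (real n powr (- 2/5))\<^sup>2" ..
  then have "W / c0 * (real n powr (- 2/5))\<^sup>2 * (h * real n) = W"
    unfolding h using c0 by (simp add: field_simps)
  moreover have "h * real n \<noteq> 0" using p c0 by (simp add: h)
  ultimately show "W / h / real n = W / c0 * (real n powr (- 2/5))\<^sup>2"
    by (simp add: field_simps)
qed

lemma rate_tendsto_0: "(\<lambda>n. real n powr (- 2/5)) \<longlonglongrightarrow> 0"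
  by (rule tendsto_neg_powr) (simp_all add: filterlim_real_sequentially)

lemma bandwidth_tendsto_0:
  fixes h :: "nat \<Rightarrow> real"
  assumes "\<forall>n\<ge>1. h n = c0 * real n powr (- 1/5)"
  shows "h \<longlonglongrightarrow> 0"
proof -
  have "(\<lambda>n. real n powr (- 1/5)) \<longlonglongrightarrow> 0"
    by (rule tendsto_neg_powr) (simp_all add: filterlim_real_sequentially)
  then have "(\<lambda>n. c0 * real n powr (- 1/5)) \<longlonglongrightarrow> 0"
    by (rule tendsto_mult_right_zero)
  then show ?thesis
    by (rule Lim_transform_eventually) (use assms in \<open>auto intro: eventually_sequentiallyI[of 1]\<close>)
qed

lemma eventually_near:
  fixes f :: "real \<Rightarrow> real" and h :: "nat \<Rightarrow> real"
  assumes "isCont f x" "h \<longlonglongrightarrow> 0" "0 < \<epsilon>"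
  shows "\<forall>\<^sub>F n in sequentially. \<forall>y. \<bar>y - x\<bar> \<le> h n \<longrightarrow> \<bar>f y - f x\<bar> \<le> \<epsilon>"
proof -
  obtain \<delta> where \<delta>: "0 < \<delta>" "\<And>y. \<bar>y - x\<bar> < \<delta> \<Longrightarrow> \<bar>f y - f x\<bar> < \<epsilon>"
    using assms(1,3) unfolding continuous_at_eps_delta dist_real_def by blast
  have "\<forall>\<^sub>F n in sequentially. h n < \<delta>" by (rule order_tendstoD(2)[OF assms(2) \<delta>(1)])
  then show ?thesis by eventually_elim (use \<delta>(2) in \<open>force intro: less_imp_le\<close>)
qed

context poisson_sampling
begin

context
  fixes f h k x c0
  assumes dens: "distributed M lborel X (\<lambda>y. ennreal (f y))" and f: "\<And>y. 0 \<le> f y"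
    and k: "compact_kernel k" and cont: "isCont f x"
    and c0: "0 < c0" and h: "\<forall>n\<ge>1. h n = c0 * real n powr (- 1/5)"
begin

text \<open>Smallness without a rate is all that is claimed: these averages serve only to define the
  event on which the quotient is under control.\<close>

lemma design_mean_consistent:
  assumes e: "0 < e"
  shows "\<forall>\<^sub>F n in sequentially.
    integrable M (\<lambda>w. (\<Sum>i=1..n. rescale k x (h n) (Xs i w)) / real n - f x * (\<integral>u. k u \<partial>lborel)) \<and>
    expectation (\<lambda>w. \<bar>(\<Sum>i=1..n. rescale k x (h n) (Xs i w)) / real n - f x * (\<integral>u. k u \<partial>lborel)\<bar>) \<le> e"
proof -
  obtain B where B: "0 < B" "\<And>u. \<bar>k u\<bar> \<le> B" using compact_kernel_bounded[OF k] by blast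
  define J where "J = (\<integral>u. \<bar>k u\<bar> \<partial>lborel)"
  have J: "0 \<le> J" unfolding J_def by (rule Bochner_Integration.integral_nonneg) simp
  \<comment> \<open>J + 1 keeps the denominator positive and gives \<epsilon> J at most e/2. This
    half covers the bias, the other half the fluctuation.\<close>
  define \<epsilon> where "\<epsilon> = e / (2 * (J + 1))"
  have \<epsilon>: "0 < \<epsilon>" using e J by (simp add: \<epsilon>_def)
  have \<epsilon>J: "\<epsilon> * J \<le> e / 2"
    using e J by (simp add: \<epsilon>_def field_simps)
  define W where "W = B * ((f x + \<epsilon>) * J)"
  have "(\<lambda>n. sqrt (W / c0) * real n powr (- 2/5)) \<longlonglongrightarrow> 0"
    by (rule tendsto_mult_right_zero[OF rate_tendsto_0])
  then have "\<forall>\<^sub>F n in sequentially. sqrt (W / c0) * real n powr (- 2/5) < e / 2"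
    using e by (intro order_tendstoD(2)) auto
  then show ?thesis
    using eventually_near[OF cont bandwidth_tendsto_0[OF h] \<epsilon>] eventually_ge_at_top[of 1]
  proof eventually_elim
    case (elim n)
    have hn: "h n = c0 * real n powr (- 1/5)" using h elim(3) by blast
    have hpos: "0 < h n" using c0 elim(3) by (simp add: hn)
    note * = expectation_abs_design_mean_le[OF elim(3) dens f k B(2) hpos elim(2), folded J_def, folded W_def]
    have "sqrt (W / h n / real n) = sqrt (W / c0) * real n powr (- 2/5)"
      unfolding bandwidth_rate(2)[OF elim(3) c0 hn] by (simp only: sqrt_mult_square powr_ge_zero)
    with *(2) elim(1) \<epsilon>J have "expectation (\<lambda>w. \<bar>(\<Sum>i=1..n. rescale k x (h n) (Xs i w)) / real n - f x * (\<integral>u. k u \<partial>lborel)\<bar>) \<le> e"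
      by linarith
    with *(1) show ?case by (intro conjI)
  qed
qed

lemma response_mean_rate:
  assumes reg: "regression_function M X \<tau> m"
    and \<rho>: "0 < \<rho>" and R: "0 \<le> R" and taylor: "\<And>y. \<bar>y - x\<bar> \<le> \<rho> \<Longrightarrow> \<bar>m y - (a + d * (y - x))\<bar> \<le> R * (y - x)\<^sup>2"
    and \<alpha>: "\<forall>\<^sub>F n in sequentially. 1 \<le> \<alpha> n"
  shows "\<exists>C. \<forall>\<^sub>F n in sequentially.
    integrable M (\<lambda>w. (\<Sum>i=1..n. rescale k x (h n) (Xs i w) *
      (real (N n i w T) / \<alpha> n - (a + d * (Xs i w - x)))) / real n) \<and>
    expectation (\<lambda>w. \<bar>(\<Sum>i=1..n. rescale k x (h n) (Xs i w) *
      (real (N n i w T) / \<alpha> n - (a + d * (Xs i w - x)))) / real n\<bar>) \<le> C * real n powr (- 2/5)"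
proof -
  obtain B where B: "0 < B" "\<And>u. \<bar>k u\<bar> \<le> B" using compact_kernel_bounded[OF k] by blast
  \<comment> \<open>Eventually the density stays within 1 of \<open>f x\<close> on the window, so
    tolerance 1 is enough here.\<close>
  define I where "I = (f x + 1) * (\<integral>u. \<bar>k u\<bar> \<partial>lborel)"
  have I: "0 \<le> I" unfolding I_def using f[of x]
    by (intro mult_nonneg_nonneg Bochner_Integration.integral_nonneg) auto
  define Q where "Q = b + \<bar>a\<bar> + \<bar>d\<bar>"
  \<comment> \<open>h below \<rho> makes the Taylor bound valid on the whole window, and h below 1
    lets Q replace the factor that depends on h.\<close>
  have h0: "\<forall>\<^sub>F n in sequentially. h n < min \<rho> 1"
    using \<rho> by (intro order_tendstoD(2)[OF bandwidth_tendsto_0[OF h]]) auto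
  let ?C = "sqrt (b * (B * I) / c0) + sqrt (Q\<^sup>2 * (B * I) / c0) + R * c0\<^sup>2 * I"
  show ?thesis
  proof (rule exI[of _ ?C])
    show "\<forall>\<^sub>F n in sequentially.
      integrable M (\<lambda>w. (\<Sum>i=1..n. rescale k x (h n) (Xs i w) *
        (real (N n i w T) / \<alpha> n - (a + d * (Xs i w - x)))) / real n) \<and>
      expectation (\<lambda>w. \<bar>(\<Sum>i=1..n. rescale k x (h n) (Xs i w) *
        (real (N n i w T) / \<alpha> n - (a + d * (Xs i w - x)))) / real n\<bar>) \<le> ?C * real n powr (- 2/5)"
      using h0 \<alpha> eventually_near[OF cont bandwidth_tendsto_0[OF h] zero_less_one] eventually_ge_at_top[of 1]
    proof eventually_elim
      case (elim n)
      let ?r = "real n powr (- 2/5)"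
      have hn: "h n = c0 * real n powr (- 1/5)" using h elim(4) by blast
      have hpos: "0 < h n" using c0 elim(4) by (simp add: hn)
      have taylor': "\<forall>y. \<bar>y - x\<bar> \<le> h n \<longrightarrow> \<bar>m y - (a + d * (y - x))\<bar> \<le> R * (h n)\<^sup>2"
      proof (intro allI impI)
        fix y assume y: "\<bar>y - x\<bar> \<le> h n"
        then have "(y - x)\<^sup>2 \<le> (h n)\<^sup>2" using hpos by (simp add: abs_le_square_iff[symmetric])
        then have "R * (y - x)\<^sup>2 \<le> R * (h n)\<^sup>2" using R by (rule mult_left_mono)
        moreover have "\<bar>m y - (a + d * (y - x))\<bar> \<le> R * (y - x)\<^sup>2" using y elim(1) by (intro taylor) simp
        ultimately show "\<bar>m y - (a + d * (y - x))\<bar> \<le> R * (h n)\<^sup>2" by linarith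
      qed
      note rate = bandwidth_rate[OF elim(4) c0 hn]
      note * = expectation_abs_response_mean_le[OF elim(4) dens f k B(2) hpos elim(3) reg taylor', folded I_def]
      have bI: "0 \<le> b * (B * I / h n)" using b_nonneg B(1) I hpos by simp
      have "b * (B * I / h n) / \<alpha> n \<le> b * (B * I / h n)"
        using frac_le[OF bI order_refl zero_less_one elim(2)] by (simp only: div_by_1)
      then have "sqrt (b * (B * I / h n) / \<alpha> n / real n) \<le> sqrt (b * (B * I) / h n / real n)"
        by (intro real_sqrt_le_mono divide_right_mono) auto
      also have "\<dots> = sqrt (b * (B * I) / c0) * ?r"
        unfolding rate(2) by (simp only: sqrt_mult_square powr_ge_zero)
      finally have 1: "sqrt (b * (B * I / h n) / \<alpha> n / real n) \<le> sqrt (b * (B * I) / c0) * ?r" .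
      have "(b + \<bar>a\<bar> + \<bar>d\<bar> * h n)\<^sup>2 \<le> Q\<^sup>2"
        unfolding Q_def using b_nonneg hpos elim(1) by (intro power_mono add_mono order_refl mult_left_le) auto
      then have "(b + \<bar>a\<bar> + \<bar>d\<bar> * h n)\<^sup>2 * (B * I / h n) \<le> Q\<^sup>2 * (B * I / h n)"
        using B(1) I hpos by (intro mult_right_mono) auto
      then have "sqrt ((b + \<bar>a\<bar> + \<bar>d\<bar> * h n)\<^sup>2 * (B * I / h n) / real n) \<le> sqrt (Q\<^sup>2 * (B * I) / h n / real n)"
        by (intro real_sqrt_le_mono divide_right_mono) auto
      also have "\<dots> = sqrt (Q\<^sup>2 * (B * I) / c0) * ?r"
        unfolding rate(2) by (simp only: sqrt_mult_square powr_ge_zero)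
      finally have 2: "sqrt ((b + \<bar>a\<bar> + \<bar>d\<bar> * h n)\<^sup>2 * (B * I / h n) / real n) \<le> sqrt (Q\<^sup>2 * (B * I) / c0) * ?r" .
      have 3: "R * (h n)\<^sup>2 * I = R * c0\<^sup>2 * I * ?r" unfolding rate(1) by simp
      have "?C * ?r = sqrt (b * (B * I) / c0) * ?r + sqrt (Q\<^sup>2 * (B * I) / c0) * ?r + R * c0\<^sup>2 * I * ?r"
        by (simp only: distrib_right)
      with *(2) 1 2 3 have "expectation (\<lambda>w. \<bar>(\<Sum>i=1..n. rescale k x (h n) (Xs i w) *
        (real (N n i w T) / \<alpha> n - (a + d * (Xs i w - x)))) / real n\<bar>) \<le> ?C * ?r"
        by linarith
      with *(1) show ?case by (intro conjI)
    qed
  qed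
qed

end

text \<open>The available bound is of order n^(-1/2); 1/n is at most n^(-4/5), so it also fits the
  common rate n^(-2/5).\<close>

lemma mean_count_rate:
  assumes \<alpha>: "\<forall>\<^sub>F n in sequentially. 1 \<le> \<alpha> n"
  shows "\<forall>\<^sub>F n in sequentially.
    integrable M (\<lambda>w. (\<Sum>i=1..n. real (N n i w T) / \<alpha> n) / real n - expectation \<tau>) \<and>
    expectation (\<lambda>w. \<bar>(\<Sum>i=1..n. real (N n i w T) / \<alpha> n) / real n - expectation \<tau>\<bar>)
      \<le> (sqrt b + b) * real n powr (- 2/5)"
  using \<alpha> eventually_ge_at_top[of 1]
proof eventually_elim
  case (elim n)
  let ?r = "real n powr (- 2/5)"
  have "1 / real n = real n powr (- 1)" using elim by (simp add: powr_minus_divide)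
  also have "\<dots> \<le> real n powr (- 4/5)" using elim by (intro powr_mono) auto
  also have "\<dots> = ?r\<^sup>2" by (simp add: power2_eq_square flip: powr_add)
  finally have r: "1 / real n \<le> ?r\<^sup>2" .
  have sq: "sqrt (c / real n) \<le> sqrt c * ?r" if "0 \<le> c" for c
  proof -
    have "sqrt (c / real n) \<le> sqrt (c * ?r\<^sup>2)"
      using mult_left_mono[OF r that] by (intro real_sqrt_le_mono) simp
    then show ?thesis by (simp only: sqrt_mult_square powr_ge_zero)
  qed
  have "b / \<alpha> n \<le> b" using frac_le[OF b_nonneg order_refl zero_less_one elim(1)] by (simp only: div_by_1)
  then have "sqrt (b / \<alpha> n / real n) \<le> sqrt (b / real n)"
    by (intro real_sqrt_le_mono divide_right_mono) auto
  then have "sqrt (b / \<alpha> n / real n) \<le> sqrt b * ?r"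
    using sq[OF b_nonneg] by linarith
  moreover have "sqrt (b\<^sup>2 / real n) \<le> b * ?r"
    using sq[of "b\<^sup>2"] b_nonneg by simp
  ultimately have "sqrt (b / \<alpha> n / real n) + sqrt (b\<^sup>2 / real n) \<le> (sqrt b + b) * ?r"
    unfolding distrib_right by linarith
  with expectation_abs_mean_count_le[OF elim(2)] show ?case by (meson order_trans)
qed

lemma tau_tilde_measurable:
  assumes n: "1 \<le> n" and K [measurable]: "K \<in> borel_measurable borel"
  shows "(\<lambda>w. tau_tilde K h x n (\<lambda>i. Xs i w) (\<lambda>i. N n i w T)) \<in> borel_measurable M"
proof -
  have X: "Xs i \<in> borel_measurable M" if "i \<in> {1..n}" for i using Xs_M_measurable that by simp
  have N: "(\<lambda>w. real (N n i w T)) \<in> borel_measurable M" if "i \<in> {1..n}" for i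
    using measurable_compose[OF count_measurable[OF that], of real borel] by simp
  have Ks: "(\<lambda>w. K_scaled K h (Xs i w - x)) \<in> borel_measurable M" if "i \<in> {1..n}" for i
  proof -
    note [measurable] = X[OF that]
    show ?thesis unfolding K_scaled_def by measurable
  qed
  have u [measurable]: "(\<lambda>w. u_hat K h x n (\<lambda>i. Xs i w) j) \<in> borel_measurable M" for j
    unfolding u_hat_def using Ks X
    by (intro borel_measurable_divide borel_measurable_sum borel_measurable_times borel_measurable_power
        borel_measurable_diff borel_measurable_const)
  have s: "(\<lambda>w. s_weight K h x n (\<lambda>i. Xs i w) i) \<in> borel_measurable M" if "i \<in> {1..n}" for i
  proof -
    note [measurable] = X[OF that] Ks[OF that]
    show ?thesis unfolding s_weight_def sigma0_sq_hat_def by measurable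
  qed
  show ?thesis
    unfolding tau_tilde_def using s N
    by (intro borel_measurable_max borel_measurable_divide borel_measurable_sum borel_measurable_times
        borel_measurable_const)
qed

end

section \<open>Taylor's bound at x and the assembly of all estimates\<close>

lemma twice_cont_diff_near_isCont:
  assumes "twice_cont_diff_near f x"
  shows "isCont f x"
  using assms unfolding twice_cont_diff_near_def by (blast intro: DERIV_isCont)

text \<open>The slope d is the derivative at x. R comes from continuity of the second derivative on
  a closed ball inside the neighbourhood, where it is bounded by compactness.\<close>

lemma twice_cont_diff_near_taylor:
  assumes "twice_cont_diff_near g x"
  obtains \<rho> R d where "0 < \<rho>" "0 \<le> R" "\<And>y. \<bar>y - x\<bar> \<le> \<rho> \<Longrightarrow> \<bar>g y - (g x + d * (y - x))\<bar> \<le> R * (y - x)\<^sup>2"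
proof -
  obtain U g' g'' where U: "open U" "x \<in> U" and cont: "continuous_on U g''"
    and deriv: "\<And>y. y \<in> U \<Longrightarrow> (g has_real_derivative g' y) (at y)"
      "\<And>y. y \<in> U \<Longrightarrow> (g' has_real_derivative g'' y) (at y)"
    using assms unfolding twice_cont_diff_near_def by blast
  obtain \<rho> where \<rho>: "0 < \<rho>" "cball x \<rho> \<subseteq> U" using U open_contains_cball by blast
  have "compact (g'' ` cball x \<rho>)"
    using \<rho>(2) by (intro compact_continuous_image continuous_on_subset[OF cont]) auto
  then have "bounded (g'' ` cball x \<rho>)" by (rule compact_imp_bounded)
  then obtain R where R: "0 < R" "\<And>y. y \<in> cball x \<rho> \<Longrightarrow> \<bar>g'' y\<bar> \<le> R"
    unfolding bounded_pos by auto
  have "\<bar>g y - (g x + g' x * (y - x))\<bar> \<le> R * (y - x)\<^sup>2" if y: "\<bar>y - x\<bar> \<le> \<rho>" for y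
  proof (cases "y = x")
    case False
    \<comment> \<open>The derivatives of order 0, 1, 2 as the sequence required by
      \<open>Taylor\<close>, which also demands y different from x; hence the case
      distinction.\<close>
    let ?diff = "\<lambda>k :: nat. if k = 0 then g else if k = 1 then g' else g''"
    have D: "DERIV (?diff k) t :> ?diff (Suc k) t" if "k < 2" "x - \<rho> \<le> t" "t \<le> x + \<rho>" for k :: nat and t
    proof -
      have "t \<in> U" using that \<rho>(2) by (auto simp: subset_eq dist_real_def)
      with that(1) deriv show ?thesis by (auto simp: less_2_cases_iff)
    qed
    have "\<exists>t. (if y < x then y < t \<and> t < x else x < t \<and> t < y) \<and>
      g y = (\<Sum>k<2. (?diff k x / fact k) * (y - x) ^ k) + (?diff 2 t / fact 2) * (y - x) ^ 2"
      using D y \<rho>(1) False by (intro Taylor[of 2 ?diff g "x - \<rho>" "x + \<rho>" x y]) auto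
    then obtain t where t: "if y < x then y < t \<and> t < x else x < t \<and> t < y"
      and eq: "g y = g x + g' x * (y - x) + g'' t / 2 * (y - x)\<^sup>2"
      by (auto simp: numeral_2_eq_2)
    have "t \<in> cball x \<rho>" using t y by (auto simp: dist_real_def split: if_splits)
    then have "\<bar>g'' t / 2\<bar> \<le> R" using R by fastforce
    then have "\<bar>g'' t / 2\<bar> * (y - x)\<^sup>2 \<le> R * (y - x)\<^sup>2" by (rule mult_right_mono) simp
    then show ?thesis unfolding eq by (simp add: abs_mult)
  qed simp
  with \<rho>(1) R(1) that show thesis by (meson less_imp_le)
qed

theorem theorem2:
  fixes M :: "'w measure" and T x \<delta> \<sigma>bar \<kappa> M1 c0 :: real
    and X :: "'w \<Rightarrow> real" and L :: "'w \<Rightarrow> real \<Rightarrow> real"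
    and Xs :: "nat \<Rightarrow> 'w \<Rightarrow> real" and Ls :: "nat \<Rightarrow> 'w \<Rightarrow> real \<Rightarrow> real"
    and N :: "nat \<Rightarrow> nat \<Rightarrow> 'w \<Rightarrow> real \<Rightarrow> nat"
    and \<alpha> h :: "nat \<Rightarrow> real" and K fX m \<sigma>2 \<psi> :: "real \<Rightarrow> real"
    and \<tau> e :: "'w \<Rightarrow> real"
  defines "\<tau> \<equiv> \<lambda>w. total_mass T (L w)"
    and "e \<equiv> \<lambda>w. \<tau> w - m (X w)"
  assumes model: "sampling_model M T X L Xs Ls \<alpha> N"
    and K: "smoothing_kernel K"
    and bandwidth_pos: "\<forall>n\<ge>1. 0 < h n"
    and fX_density: "\<forall>y. 0 \<le> fX y" "distributed M lborel X (\<lambda>y. ennreal (fX y))"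
    and m_reg: "regression_function M X \<tau> m"
    and \<sigma>2_reg: "regression_function M X (\<lambda>w. (e w)\<^sup>2) \<sigma>2"
    and i: "twice_cont_diff_near m x" "twice_cont_diff_near fX x" "0 < fX x"
           "twice_cont_diff_near \<sigma>2 x"
    and ii: "(\<lambda>n. real n * h n ^ 5) \<in> O(\<lambda>_. 1)"
    and iii: "0 < \<delta>" "0 < \<sigma>bar"
             "AE w in M. real_cond_exp M (vimage_algebra (space M) X borel)
                (\<lambda>v. \<bar>e v\<bar> powr (2 + \<delta>)) w \<le> \<sigma>bar"
    and iv: "0 < \<kappa>" "\<kappa> \<le> M1" "AE w in M. \<kappa> \<le> \<tau> w \<and> \<tau> w \<le> M1"
    and v: "same_order (\<lambda>n. \<psi> (\<alpha> n)) (\<lambda>n. real n powr (2/5))"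
    and vi: "0 < c0" "\<forall>n\<ge>1. h n = c0 * real n powr (- 1/5)"
    and vii: "filterlim (\<lambda>n. \<alpha> n / ln (real n)) at_top sequentially"
  shows "bigO_prob M
    (\<lambda>n w. tau_tilde K (h n) x n (\<lambda>i. Xs i w) (\<lambda>i. N n i w T)
             - max (m x) 0 / prob_space.expectation M \<tau>)
    (\<lambda>n. real n powr (- 2/5))"
proof -
  \<comment> \<open>The upper bound M1 on the total mass takes the role of the parameter b.\<close>
  interpret S: poisson_sampling M T X L Xs Ls \<alpha> N M1
  proof -
    interpret prob_space M using model by (simp add: sampling_model_def)
    show "poisson_sampling M T X L Xs Ls \<alpha> N M1"
    proof unfold_locales
      show "AE w in M. 0 \<le> total_mass T (L w) \<and> total_mass T (L w) \<le> M1"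
        using iv(3) unfolding \<tau>_def by eventually_elim (use iv(1) in auto)
    qed (rule model)
  qed
  have S\<tau>: "S.\<tau> = \<tau>" by (rule ext) (simp add: S.\<tau>_def \<tau>_def)
  have f: "\<And>y. 0 \<le> fX y" using fX_density(1) by blast
  note reg = m_reg[folded S\<tau>]
  have cont: "isCont fX x" by (rule twice_cont_diff_near_isCont[OF i(2)])
  define k where "k j = (\<lambda>u. K u * u ^ j)" for j :: nat
  have k: "compact_kernel (k j)" for j unfolding k_def by (rule compact_kernel_monomial[OF K])
  define s where "s = (\<integral>u. k 2 u \<partial>lborel)"
  have s: "0 < s" unfolding s_def k_def by (rule smoothing_kernel_second_moment_pos[OF K])
  have k0: "(\<integral>u. k 0 u \<partial>lborel) = 1" using smoothing_kernel_integral[OF K] by (simp add: k_def)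
  have k1: "(\<integral>u. k 1 u \<partial>lborel) = 0" using smoothing_kernel_first_moment[OF K] by (simp add: k_def)
  define \<mu> where "\<mu> = S.expectation \<tau>"
  have \<mu>: "0 < \<mu>"
  proof -
    have "integrable M \<tau>" using m_reg by (simp add: regression_function_def)
    then have "S.expectation (\<lambda>_. \<kappa>) \<le> S.expectation \<tau>"
      using iv(3) by (intro integral_mono_AE) auto
    then show ?thesis using iv(1) by (simp add: \<mu>_def S.prob_space)
  qed
  obtain \<rho> R d where taylor: "0 < \<rho>" "0 \<le> R"
      "\<And>y. \<bar>y - x\<bar> \<le> \<rho> \<Longrightarrow> \<bar>m y - (m x + d * (y - x))\<bar> \<le> R * (y - x)\<^sup>2"
    using twice_cont_diff_near_taylor[OF i(1)] by blast
  obtain \<eta> C where \<eta>: "0 < \<eta>" and C: "0 < C"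
    and ratio: "\<And>U0 U1 U2 D0 D1 B. \<bar>U0 - fX x\<bar> + \<bar>U1\<bar> + \<bar>U2 - fX x * s\<bar> + \<bar>B - \<mu>\<bar> < \<eta> \<Longrightarrow> 0 < U0 * U2 - U1\<^sup>2 \<and>
      \<bar>max 0 ((m x + (U2 * D0 - U1 * D1) / (U0 * U2 - U1\<^sup>2)) / B) - max (m x) 0 / \<mu>\<bar>
        \<le> C * (\<bar>D0\<bar> + \<bar>D1\<bar> + \<bar>B - \<mu>\<bar>)"
    using local_linear_ratio_bound[OF i(3) s \<mu>, of "m x"] by blast
  \<comment> \<open>Eventually \<alpha> is at least ln n, and ln n is at least 1 from n = 3 on
    because exp 1 is at most 3.\<close>
  have \<alpha>1: "\<forall>\<^sub>F n in sequentially. 1 \<le> \<alpha> n"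
  proof -
    have "\<forall>\<^sub>F n in sequentially. 1 \<le> \<alpha> n / ln (real n)"
      using vii by (simp add: filterlim_at_top)
    then show ?thesis using eventually_ge_at_top[of 3]
    proof eventually_elim
      case (elim n)
      have "1 \<le> ln (real n)" using elim(2) exp_le by (subst ln_ge_iff) linarith+
      with elim(1) show ?case by (simp add: le_divide_eq)
    qed
  qed
  define U where "U j n w = (\<Sum>i=1..n. rescale (k j) x (h n) (Xs i w)) / real n" for j n w
  define D where "D j n w = (\<Sum>i=1..n. rescale (k j) x (h n) (Xs i w) *
      (real (N n i w T) / \<alpha> n - (m x + d * (Xs i w - x)))) / real n" for j n w
  define B where "B n w = (\<Sum>i=1..n. real (N n i w T) / \<alpha> n) / real n" for n w
  \<comment> \<open>V collects the distances of all ingredients of the denominators from their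
    limits, W the errors that need a rate. The mean count enters both: it must be close to \<mu> for
    the bound to apply, and its error contributes to the result.\<close>
  define V where "V n w = \<bar>U 0 n w - fX x\<bar> + \<bar>U 1 n w\<bar> + \<bar>U 2 n w - fX x * s\<bar> + \<bar>B n w - \<mu>\<bar>" for n w
  define W where "W n w = \<bar>D 0 n w\<bar> + \<bar>D 1 n w\<bar> + \<bar>B n w - \<mu>\<bar>" for n w
  let ?r = "\<lambda>n. real n powr (- 2/5)"
  note design = S.design_mean_consistent[OF fX_density(2) f k cont vi]
  have U0: "\<forall>\<^sub>F n in sequentially. integrable M (\<lambda>w. U 0 n w - fX x) \<and> S.expectation (\<lambda>w. \<bar>U 0 n w - fX x\<bar>) \<le> e" if "0 < e" for e
    using design[OF that, of 0] by (simp add: U_def k0)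
  have U1: "\<forall>\<^sub>F n in sequentially. integrable M (U 1 n) \<and> S.expectation (\<lambda>w. \<bar>U 1 n w\<bar>) \<le> e" if "0 < e" for e
    using design[OF that, of 1] unfolding k1 U_def[abs_def] by simp
  have U2: "\<forall>\<^sub>F n in sequentially. integrable M (\<lambda>w. U 2 n w - fX x * s) \<and> S.expectation (\<lambda>w. \<bar>U 2 n w - fX x * s\<bar>) \<le> e" if "0 < e" for e
    using design[OF that, of 2] by (simp add: U_def s_def)
  note response = S.response_mean_rate[OF fX_density(2) f k cont vi reg taylor \<alpha>1, folded D_def]
  obtain C0 where D0: "\<forall>\<^sub>F n in sequentially. integrable M (\<lambda>w. D 0 n w) \<and> S.expectation (\<lambda>w. \<bar>D 0 n w\<bar>) \<le> C0 * ?r n"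
    using response by blast
  obtain C1 where D1: "\<forall>\<^sub>F n in sequentially. integrable M (\<lambda>w. D 1 n w) \<and> S.expectation (\<lambda>w. \<bar>D 1 n w\<bar>) \<le> C1 * ?r n"
    using response by blast
  obtain C2 where B: "\<forall>\<^sub>F n in sequentially. integrable M (\<lambda>w. B n w - \<mu>) \<and> S.expectation (\<lambda>w. \<bar>B n w - \<mu>\<bar>) \<le> C2 * ?r n"
    using S.mean_count_rate[OF \<alpha>1, unfolded S\<tau>, folded \<mu>_def B_def] by blast
  have Vlim: "\<forall>\<^sub>F n in sequentially. integrable M (V n) \<and> S.expectation (V n) \<le> e" if e: "0 < e" for e
  proof -
    have e4: "0 < e / 4" using e by simp
    have "(\<lambda>n. C2 * ?r n) \<longlonglongrightarrow> 0" by (rule tendsto_mult_right_zero[OF rate_tendsto_0])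
    then have "\<forall>\<^sub>F n in sequentially. C2 * ?r n < e / 4" by (rule order_tendstoD(2)[OF _ e4])
    then show ?thesis
      using U0[OF e4] U1[OF e4] U2[OF e4] B
    proof eventually_elim
      case (elim n)
      note int = elim(2)[THEN conjunct1, THEN integrable_abs] elim(3)[THEN conjunct1, THEN integrable_abs]
        elim(4)[THEN conjunct1, THEN integrable_abs] elim(5)[THEN conjunct1, THEN integrable_abs]
      have "S.expectation (V n) = S.expectation (\<lambda>w. \<bar>U 0 n w - fX x\<bar>) + S.expectation (\<lambda>w. \<bar>U 1 n w\<bar>)
        + S.expectation (\<lambda>w. \<bar>U 2 n w - fX x * s\<bar>) + S.expectation (\<lambda>w. \<bar>B n w - \<mu>\<bar>)"
        unfolding V_def[abs_def] using int by simp
      also have "\<dots> \<le> e" using elim by linarith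
      finally show ?case unfolding V_def[abs_def] using int by simp
    qed
  qed
  have Wrate: "\<forall>\<^sub>F n in sequentially. integrable M (W n) \<and> S.expectation (W n) \<le> (C0 + C1 + C2) * ?r n"
    using D0 D1 B
  proof eventually_elim
    case (elim n)
    note int = elim(1)[THEN conjunct1, THEN integrable_abs] elim(2)[THEN conjunct1, THEN integrable_abs]
      elim(3)[THEN conjunct1, THEN integrable_abs]
    have "S.expectation (W n) = S.expectation (\<lambda>w. \<bar>D 0 n w\<bar>) + S.expectation (\<lambda>w. \<bar>D 1 n w\<bar>)
      + S.expectation (\<lambda>w. \<bar>B n w - \<mu>\<bar>)"
      unfolding W_def[abs_def] using int by simp
    also have "\<dots> \<le> (C0 + C1 + C2) * ?r n" unfolding distrib_right using elim by linarith
    finally show ?case unfolding W_def[abs_def] using int by simp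
  qed
  let ?Z = "\<lambda>n w. tau_tilde K (h n) x n (\<lambda>i. Xs i w) (\<lambda>i. N n i w T) - max (m x) 0 / \<mu>"
  \<comment> \<open>On \<open>V n w < \<eta>\<close> the determinant is positive and the mean count
    is close to \<mu>, so the values assigned by division by zero do not occur there and the closed
    formula for the estimator holds.\<close>
  have dom: "\<bar>?Z n w\<bar> \<le> C * W n w" if n: "1 \<le> n" and V: "V n w < \<eta>" for n w
  proof -
    note bound = ratio[OF V[unfolded V_def], of "D 0 n w" "D 1 n w"]
    have hn: "0 < h n" using bandwidth_pos n by blast
    have "tau_tilde K (h n) x n (\<lambda>i. Xs i w) (\<lambda>i. N n i w T) =
      max 0 ((m x + (U 2 n w * D 0 n w - U 1 n w * D 1 n w) / (U 0 n w * U 2 n w - (U 1 n w)\<^sup>2)) / B n w)"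
      unfolding U_def D_def B_def k_def
    proof (rule tau_tilde_eq[OF hn S.\<alpha>_pos[OF n] n])
      show "(\<Sum>i=1..n. rescale (\<lambda>u. K u * u ^ 0) x (h n) (Xs i w)) / real n *
        ((\<Sum>i=1..n. rescale (\<lambda>u. K u * u ^ 2) x (h n) (Xs i w)) / real n) -
        ((\<Sum>i=1..n. rescale (\<lambda>u. K u * u ^ 1) x (h n) (Xs i w)) / real n)\<^sup>2 \<noteq> 0"
        using conjunct1[OF bound] unfolding U_def k_def by simp
    qed
    with bound show ?thesis unfolding W_def by simp
  qed
  have "bigO_prob M ?Z ?r"
  proof (rule S.bigO_prob_from_moments[where V=V and W=W and C="C0 + C1 + C2", OF _ Vlim Wrate _ _ _ \<eta> C])
    have "K \<in> borel_measurable borel"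
      using compact_kernel_measurable[OF k[of 0]] by (simp add: k_def)
    then show "?Z n \<in> borel_measurable M" if "1 \<le> n" for n
      using S.tau_tilde_measurable[OF that] by measurable
    show "\<forall>\<^sub>F n in sequentially. \<forall>w\<in>space M. V n w < \<eta> \<longrightarrow> \<bar>?Z n w\<bar> \<le> C * W n w"
      using eventually_ge_at_top[of 1] by eventually_elim (use dom in blast)
  qed (auto simp: V_def W_def)
  then show ?thesis unfolding \<mu>_def .
qed

end
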